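(* Computable embeddability of computable subgroups of $(\mathbb{Q},+)$ is complete for $\Sigma^0_3$ preorders. That is, the relation $\{(i,j): G_i\text{ is computably embeddable in }G_j\}$ is a $\Sigma^0_3$ preorder on $\mathbb{N}$, and for every $\Sigma^0_3$ preorder $P$ on $\mathbb{N}$ there is a computable $f:\mathbb{N}\to\mathbb{N}$ such that for all $x,y\in\mathbb{N}$: $$(x,y)\in P\iff G_{f(x)}\text{ is computably embeddable in }G_{f(y)}.$$
   Context: A computable subgroup of $(\mathbb{Q},+)$ is a 4-tuple of (total) computable functions $(e,\oplus,\ominus,I)$. Natural numbers encode group elements, not necessarily uniquely. $I:\mathbb{N}\to\mathbb{Q}$ (with a fixed encoding of $\mathbb{Q}$) is the interpretation function; $\oplus:\mathbb{N}\times\mathbb{N}\to\mathbb{N}$ encodes the group operation, $\ominus:\mathbb{N}\to\mathbb{N}$ inverses, and $e:\mathbb{N}\to\{0,1\}$ takes value $1$ exactly on codes of the identity. It is required that $I(\oplus(a,b))=I(a)+I(b)$ and that the group axioms hold through $I$: $I(\oplus(\oplus(a,b),c))=I(\oplus(a,\oplus(b,c)))$; if $e(x)=1$ then $I(\oplus(a,x))=I(\oplus(x,a))=I(a)$; and $e(\oplus(a,\ominus(a)))=1$. The subgroup represented is $I(\mathbb{N})\subseteq\mathbb{Q}$. Indexing: let $W_i$ be the $i$th recursively enumerable set, viewed as a set of pairs $(x,y)$ of natural numbers, closed downward in the second component. Let $p_0=1$ and let $p_x$ ($x\ge1$) be the $x$th prime. $G_i$ is the computable subgroup of $\mathbb{Q}$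 generated by $1$ together with all $1/p_x^y$, $(x,y)\in W_i$, presented uniformly computably in $i$ as follows: let $w_0=1$ and for $s\ge1$ let $w_s=1/p_x^y$ if $(x,y)$ enters $W_i$ at stage $s$ and $w_s=0$ if no element enters; if $a$ encodes the finite integer sequence $z_0\dots z_n$, let $I(a)=z_0w_0+\dots+z_nw_n$; let $I^{-1}(q)$ be the least $a$ with $I(a)=q$; let $\oplus(a,b)=I^{-1}(I(a)+I(b))$, $\ominus(a)=I^{-1}(-I(a))$, and $e(a)=1$ iff $I(a)=0$. (Every computable subgroup of $(\mathbb{Q},+)$ containing $1$ is some $G_i$.) A computable embedding of $(e_1,\oplus_1,\ominus_1,I_1)$ into $(e_2,\oplus_2,\ominus_2,I_2)$ is a total computable $\varphi:\mathbb{N}\to\mathbb{N}$ such that $I_1(a)\mapsto I_2(\varphi(a))$ is a well-defined injective group homomorphism $I_1(\mathbb{N})\to I_2(\mathbb{N})$. A preorder is a reflexive transitive relation; a $\Sigma^0_3$ preorder is one that is $\Sigma^0_3$ as a set of pairs. Completeness is with respect to computable component-wise reducibility: $R\le S$ iff there is a computable $f$ with $(x,y)\in R\iff(f(x),f(y))\in S$ for all $x,y$. *)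

theory Defs
  imports Complex_Main "HOL-Library.Nat_Bijection" "HOL-Library.Infinite_Set"
    "HOL-Computational_Algebra.Primes"
begin

section \<open>Partial recursive functions\<close>

text \<open>
  The partial recursive functions in their unary presentation: arguments and tuples are combined
  with the Cantor pairing function \<^const>\<open>prod_encode\<close>.
\<close>

abbreviation pair :: "nat \<Rightarrow> nat \<Rightarrow> nat" where
  "pair a b \<equiv> prod_encode (a, b)"

datatype prog =
    Zero
  | Succ
  | Left
  | Right
  | Pairing prog prog
  | Comp prog prog
  | PrimRec prog prog
  | Search prog

text \<open>
  \<open>eval p x y t\<close>: the program \<open>p\<close> halts on input \<open>x\<close> with output \<open>y\<close>, in exactly \<open>t\<close> steps
  (the number of rule applications). On input \<open>pair a m\<close>, \<open>Search f\<close> computes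
  the least \<open>n \<ge> m\<close> such that \<open>f\<close> has value 0 on \<open>pair a n\<close>, provided that \<open>f\<close> halts on
  \<open>pair a k\<close> for all \<open>k\<close> between \<open>m\<close> and \<open>n\<close>; the usual unbounded minimisation is the case \<open>m = 0\<close>.
\<close>

inductive eval :: "prog \<Rightarrow> nat \<Rightarrow> nat \<Rightarrow> nat \<Rightarrow> bool" where
  Zero: "eval Zero x 0 1"
| Succ: "eval Succ x (Suc x) 1"
| Left: "eval Left (pair a b) a 1"
| Right: "eval Right (pair a b) b 1"
| Pairing: "eval f x y s \<Longrightarrow> eval g x z t \<Longrightarrow> eval (Pairing f g) x (pair y z) (Suc (s + t))"
| Comp: "eval g x y s \<Longrightarrow> eval f y z t \<Longrightarrow> eval (Comp f g) x z (Suc (s + t))"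
| PrimRec_0: "eval f a y t \<Longrightarrow> eval (PrimRec f g) (pair a 0) y (Suc t)"
| PrimRec_Suc: "eval (PrimRec f g) (pair a n) r s \<Longrightarrow> eval g (pair a (pair n r)) y t
    \<Longrightarrow> eval (PrimRec f g) (pair a (Suc n)) y (Suc (s + t))"
| Search_stop: "eval f (pair a m) 0 t \<Longrightarrow> eval (Search f) (pair a m) m (Suc t)"
| Search_next: "eval f (pair a m) (Suc r) s \<Longrightarrow> eval (Search f) (pair a (Suc m)) n t
    \<Longrightarrow> eval (Search f) (pair a m) n (Suc (s + t))"

fun prog_encode :: "prog \<Rightarrow> nat" where
  "prog_encode Zero = 0"
| "prog_encode Succ = 1"
| "prog_encode Left = 2"
| "prog_encode Right = 3"
| "prog_encode (Pairing f g) = 4 + 4 * pair (prog_encode f) (prog_encode g)"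
| "prog_encode (Comp f g) = 5 + 4 * pair (prog_encode f) (prog_encode g)"
| "prog_encode (PrimRec f g) = 6 + 4 * pair (prog_encode f) (prog_encode g)"
| "prog_encode (Search f) = 7 + 4 * prog_encode f"

definition computable :: "(nat \<Rightarrow> nat) \<Rightarrow> bool" where
  "computable f \<longleftrightarrow> (\<exists>p. \<forall>x. \<exists>t. eval p x (f x) t)"

definition computable2 :: "(nat \<Rightarrow> nat \<Rightarrow> nat) \<Rightarrow> bool" where
  "computable2 f \<longleftrightarrow> computable (\<lambda>n. case prod_decode n of (a, b) \<Rightarrow> f a b)"

definition decidable :: "nat set \<Rightarrow> bool" where
  "decidable A \<longleftrightarrow> computable (\<lambda>n. if n \<in> A then 1 else 0)"

definition rat_encode :: "rat \<Rightarrow> nat" where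
  "rat_encode q = (case quotient_of q of (a, b) \<Rightarrow> pair (int_encode a) (nat b))"

definition computable_to_rat :: "(nat \<Rightarrow> rat) \<Rightarrow> bool" where
  "computable_to_rat f \<longleftrightarrow> computable (\<lambda>n. rat_encode (f n))"


section \<open>\<open>\<Sigma>\<^sup>0\<^sub>3\<close> preorders\<close>

definition Sigma03 :: "(nat \<times> nat) set \<Rightarrow> bool" where
  "Sigma03 R \<longleftrightarrow> (\<exists>D. decidable D \<and>
     (\<forall>x y. (x, y) \<in> R \<longleftrightarrow> (\<exists>a. \<forall>b. \<exists>c. pair x (pair y (pair a (pair b c))) \<in> D)))"

definition Sigma03_preorder :: "(nat \<times> nat) set \<Rightarrow> bool" where
  "Sigma03_preorder R \<longleftrightarrow> preorder_on UNIV R \<and> Sigma03 R"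


section \<open>Computable subgroups of the rationals\<close>

record presentation =
  ident :: "nat \<Rightarrow> nat"
  oplus :: "nat \<Rightarrow> nat \<Rightarrow> nat"
  ominus :: "nat \<Rightarrow> nat"
  interp :: "nat \<Rightarrow> rat"

definition computable_subgroup :: "presentation \<Rightarrow> bool" where
  "computable_subgroup A \<longleftrightarrow>
     computable (ident A) \<and> computable2 (oplus A) \<and> computable (ominus A) \<and>
     computable_to_rat (interp A) \<and>
     (\<forall>x. ident A x \<in> {0, 1}) \<and>
     (\<forall>x. ident A x = 1 \<longleftrightarrow> interp A x = 0) \<and>
     (\<forall>a b. interp A (oplus A a b) = interp A a + interp A b) \<and>
     (\<forall>a b c. interp A (oplus A (oplus A a b) c) = interp A (oplus A a (oplus A b c))) \<and>
     (\<forall>a x. ident A x = 1 \<longrightarrow>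
        interp A (oplus A a x) = interp A a \<and> interp A (oplus A x a) = interp A a) \<and>
     (\<forall>a. ident A (oplus A a (ominus A a)) = 1)"

text \<open>
  The function \<open>h\<close> is the map sending \<open>interp A a\<close> to \<open>interp B (\<phi> a)\<close>; its existence expresses
  that this map is well defined. Only its restriction to \<open>range (interp A)\<close> matters.
\<close>

definition computable_embedding :: "presentation \<Rightarrow> presentation \<Rightarrow> (nat \<Rightarrow> nat) \<Rightarrow> bool" where
  "computable_embedding A B \<phi> \<longleftrightarrow>
     computable_subgroup A \<and> computable_subgroup B \<and> computable \<phi> \<and>
     (\<exists>h. (\<forall>a. h (interp A a) = interp B (\<phi> a)) \<and>
          inj_on h (range (interp A)) \<and>
          (\<forall>q \<in> range (interp A). \<forall>r \<in> range (interp A). h (q + r) = h q + h r))"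

definition computably_embeddable :: "presentation \<Rightarrow> presentation \<Rightarrow> bool" where
  "computably_embeddable A B \<longleftrightarrow> (\<exists>\<phi>. computable_embedding A B \<phi>)"


section \<open>The indexing of the computable subgroups\<close>

text \<open>
  \<open>re_at i t\<close> is the set of inputs on which the \<open>i\<close>-th program halts within \<open>t\<close> steps, so that
  \<open>re_set i\<close> is the \<open>i\<close>-th recursively enumerable set. The sets \<open>W_at i t\<close> and \<open>W i\<close> are the
  corresponding sets of pairs, closed downward in the second component.
\<close>

definition re_at :: "nat \<Rightarrow> nat \<Rightarrow> nat set" where
  "re_at i t = {x. \<exists>p y u. prog_encode p = i \<and> u \<le> t \<and> eval p x y u}"

definition re_set :: "nat \<Rightarrow> nat set" where
  "re_set i = {x. \<exists>p y u. prog_encode p = i \<and> eval p x y u}"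

definition W_at :: "nat \<Rightarrow> nat \<Rightarrow> (nat \<times> nat) set" where
  "W_at i t = {(x, y). \<exists>z. y \<le> z \<and> z \<le> t \<and> pair x z \<in> re_at i t}"

definition W :: "nat \<Rightarrow> (nat \<times> nat) set" where
  "W i = {(x, y). \<exists>z. y \<le> z \<and> pair x z \<in> re_set i}"

text \<open>
  Stages: \<open>(x, y)\<close> enters \<open>W i\<close> at stage \<open>Suc (pair (pair x y) t)\<close>, where \<open>t\<close> is least
  with \<open>(x, y) \<in> W_at i t\<close>. Hence every element of \<open>W i\<close> enters at exactly one stage,
  and at most one element enters at any given stage.
\<close>

definition enters_at :: "nat \<Rightarrow> nat \<times> nat \<Rightarrow> nat \<Rightarrow> bool" where
  "enters_at i xy s \<longleftrightarrow>
     (\<exists>t. s = Suc (pair (prod_encode xy) t) \<and> xy \<in> W_at i t \<and> (\<forall>t' < t. xy \<notin> W_at i t'))"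

lemma re_set_eq: "re_set i = (\<Union>t. re_at i t)"
  unfolding re_set_def re_at_def by blast

lemma W_eq: "W i = (\<Union>t. W_at i t)"
proof
  show "W i \<subseteq> (\<Union>t. W_at i t)"
  proof
    fix q assume "q \<in> W i"
    then obtain x y z where q: "q = (x, y)" and z: "y \<le> z" and "pair x z \<in> re_set i"
      by (auto simp: W_def)
    then obtain t where "pair x z \<in> re_at i t" by (auto simp: re_set_eq)
    then have "pair x z \<in> re_at i (max z t)"
      unfolding re_at_def using le_max_iff_disj by blast
    then have "q \<in> W_at i (max z t)" unfolding W_at_def q using z by fastforce
    then show "q \<in> (\<Union>t. W_at i t)" by blast
  qed
qed (auto simp: W_def W_at_def re_set_eq)

lemma enters_at_exists: "q \<in> W i \<longleftrightarrow> (\<exists>s. enters_at i q s)"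
proof
  assume "q \<in> W i"
  then have "\<exists>t. q \<in> W_at i t" by (simp add: W_eq)
  then have "q \<in> W_at i (LEAST t. q \<in> W_at i t)" by (rule LeastI_ex)
  then show "\<exists>s. enters_at i q s"
    unfolding enters_at_def using not_less_Least by blast
qed (auto simp: enters_at_def W_eq)

lemma enters_at_unique: "enters_at i q s \<Longrightarrow> enters_at i q' s \<Longrightarrow> q = q'"
  by (auto simp: enters_at_def)

definition prime_seq :: "nat \<Rightarrow> nat" where
  "prime_seq x = (if x = 0 then 1 else enumerate {p. prime p} (x - 1))"

definition gen_seq :: "nat \<Rightarrow> nat \<Rightarrow> rat" where
  "gen_seq i s =
     (if s = 0 then 1
      else if \<exists>xy. enters_at i xy s
      then (case (THE xy. enters_at i xy s) of (x, y) \<Rightarrow> 1 / of_nat (prime_seq x) ^ y)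
      else 0)"

text \<open>
  Finite integer sequences are coded through the bijections \<^const>\<open>list_encode\<close> and
  \<^const>\<open>int_encode\<close>; the empty sequence (coded by 0) denotes the empty sum.
\<close>

definition seq_decode :: "nat \<Rightarrow> int list" where
  "seq_decode a = map int_decode (list_decode a)"

definition G_interp :: "nat \<Rightarrow> nat \<Rightarrow> rat" where
  "G_interp i a = (\<Sum>k < length (seq_decode a). of_int (seq_decode a ! k) * gen_seq i k)"

definition G_code :: "nat \<Rightarrow> rat \<Rightarrow> nat" where
  "G_code i q = (LEAST a. G_interp i a = q)"

definition G :: "nat \<Rightarrow> presentation" where
  "G i =
     \<lparr> ident = (\<lambda>a. if G_interp i a = 0 then 1 else 0),
       oplus = (\<lambda>a b. G_code i (G_interp i a + G_interp i b)),
       ominus = (\<lambda>a. G_code i (- G_interp i a)),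
       interp = G_interp i \<rparr>"

end

theory Submission
  imports Defs
begin

text \<open>
  A homomorphism between subgroups of the rationals that contain 1 is multiplication by a rational,
  and it is automatically computable on the groups \<open>G i\<close>. So \<open>G i\<close> embeds in \<open>G j\<close> iff
  \<open>r \<cdot> G i \<subseteq> G j\<close> for some \<open>r \<noteq> 0\<close>, which is \<open>\<Sigma>\<^sup>0\<^sub>3\<close> because the interpretations
  are uniformly computable. If all columns of \<open>W i\<close> and \<open>W j\<close> have nearly the same height, such an
  \<open>r\<close> exists iff almost all columns of \<open>W i\<close> are at most as high as those of \<open>W j\<close>.

  For hardness, let \<open>x \<le> y\<close> iff \<open>\<exists>a. \<forall>b. \<exists>z. D x y a b z\<close>. Every column \<open>c\<close> is a guess
  that a finite set \<open>U\<close> of numbers is upward closed. Its height in the group of \<open>u\<close> is \<open>M\<close>, plus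
  one if \<open>u \<in> U\<close>, where \<open>M \<le> \<infinity>\<close> measures how far some triple \<open>(x, y, a)\<close> that leaves \<open>U\<close>
  appears to be correct. If \<open>a\<close> witnesses \<open>x \<le> y\<close>, then almost all columns with \<open>x \<in> U\<close> and
  \<open>y \<notin> U\<close> have \<open>M = \<infinity>\<close>. If not \<open>x \<le> y\<close>, infinitely many columns guess the true upward closure
  of \<open>x\<close> up to some bound; these have \<open>M < \<infinity>\<close>, and the groups of \<open>x\<close> and \<open>y\<close> differ there.
\<close>

section \<open>Closure properties of the computable functions\<close>

definition pfst :: "nat \<Rightarrow> nat" where "pfst n = fst (prod_decode n)"
definition psnd :: "nat \<Rightarrow> nat" where "psnd n = snd (prod_decode n)"

lemma pfst_pair [simp]: "pfst (pair a b) = a"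
  and psnd_pair [simp]: "psnd (pair a b) = b"
  and pair_pfst_psnd [simp]: "pair (pfst n) (psnd n) = n"
  by (simp_all add: pfst_def psnd_def)

lemma pair_zero [simp]: "pair 0 0 = 0"
  by (simp add: prod_encode_def)

lemma pfst_le: "pfst n \<le> n" and psnd_le: "psnd n \<le> n"
  by (metis le_prod_encode_1 pair_pfst_psnd) (metis le_prod_encode_2 pair_pfst_psnd)

lemma computableI:
  assumes "\<And>x. \<exists>t. eval p x (f x) t"
  shows "computable f"
  using assms unfolding computable_def by blast

lemma computableE:
  assumes "computable f"
  obtains p where "\<forall>x. \<exists>t. eval p x (f x) t"
  using assms unfolding computable_def by blast

lemma computable_compose:
  assumes "computable f" "computable g"
  shows "computable (\<lambda>x. f (g x))"
proof -
  obtain p where p: "\<forall>x. \<exists>t. eval p x (f x) t" using assms(1) by (rule computableE)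
  obtain q where q: "\<forall>x. \<exists>t. eval q x (g x) t" using assms(2) by (rule computableE)
  show ?thesis
    by (rule computableI[of "Comp p q"]) (meson p q eval.Comp)
qed

lemma eval_Left: "eval Left n (pfst n) 1" and eval_Right: "eval Right n (psnd n) 1"
  using eval.Left[of "pfst n" "psnd n"] eval.Right[of "pfst n" "psnd n"] by simp_all

definition Ident :: prog where "Ident = Pairing Left Right"

lemma eval_Ident: "eval Ident n n 3"
  using eval.Pairing[OF eval_Left[of n] eval_Right[of n]] by (simp add: Ident_def numeral_eq_Suc)

primrec Const :: "nat \<Rightarrow> prog" where
  "Const 0 = Zero"
| "Const (Suc n) = Comp Succ (Const n)"

lemma eval_Const: "\<exists>t. eval (Const n) x n t"
  by (induction n) (auto intro: eval.Zero eval.Comp eval.Succ)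

lemma computable_ident: "computable (\<lambda>x. x)"
  by (rule computableI) (blast intro: eval_Ident)

lemma computable_const: "computable (\<lambda>x. c)"
  by (rule computableI) (rule eval_Const)

lemma computable_Suc: "computable f \<Longrightarrow> computable (\<lambda>x. Suc (f x))"
  by (rule computable_compose[of Suc]) (auto intro: computableI eval.Succ)

lemma computable_pfst: "computable f \<Longrightarrow> computable (\<lambda>x. pfst (f x))"
  by (rule computable_compose[of pfst]) (auto intro: computableI eval_Left)

lemma computable_psnd: "computable f \<Longrightarrow> computable (\<lambda>x. psnd (f x))"
  by (rule computable_compose[of psnd]) (auto intro: computableI eval_Right)

lemma computable_pair:
  assumes "computable f" "computable g"
  shows "computable (\<lambda>x. pair (f x) (g x))"
proof -
  obtain p where p: "\<forall>x. \<exists>t. eval p x (f x) t" using assms(1) by (rule computableE)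
  obtain q where q: "\<forall>x. \<exists>t. eval q x (g x) t" using assms(2) by (rule computableE)
  show ?thesis
    by (rule computableI[of "Pairing p q"]) (meson p q eval.Pairing)
qed

text \<open>\<open>PrimRec\<close> hands its parameter unchanged to every step. Taking the input
  \<open>x\<close> itself as the parameter lets \<open>g\<close> depend on \<open>x\<close>; the
  premise on \<open>g\<close> reads the nested pair in which the rule supplies parameter, counter
  and previous value.\<close>

lemma computable_rec:
  assumes "computable f" "computable (\<lambda>z. g (pfst z) (pfst (psnd z)) (psnd (psnd z)))" "computable h"
  shows "computable (\<lambda>x. rec_nat (f x) (g x) (h x))"
proof -
  obtain p where p: "\<forall>x. \<exists>t. eval p x (f x) t" using assms(1) by (rule computableE)
  obtain q where q: "\<forall>z. \<exists>t. eval q z (g (pfst z) (pfst (psnd z)) (psnd (psnd z))) t"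
    using assms(2) by (rule computableE)
  have *: "\<exists>t. eval (PrimRec p q) (pair x n) (rec_nat (f x) (g x) n) t" for x n
  proof (induction n)
    case 0
    then show ?case using p by (auto intro: eval.PrimRec_0)
  next
    case (Suc n)
    then show ?case
      using q[rule_format, of "pair x (pair n (rec_nat (f x) (g x) n))"]
      by (auto intro: eval.PrimRec_Suc)
  qed
  have "computable (\<lambda>z. rec_nat (f (pfst z)) (g (pfst z)) (psnd z))"
    by (rule computableI[of "PrimRec p q"]) (metis * pair_pfst_psnd)
  from computable_compose[OF this computable_pair[OF computable_ident assms(3)]]
  show ?thesis by simp
qed

named_theorems computable_intros

lemmas [computable_intros] =
  computable_ident computable_const computable_Suc computable_pfst computable_psnd
  computable_pair computable_rec

section \<open>Arithmetic by primitive recursion\<close>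

lemma computable_add [computable_intros]:
  assumes "computable f" "computable g"
  shows "computable (\<lambda>x. f x + g x)"
proof -
  have "rec_nat a (\<lambda>_ r. Suc r) b = a + b" for a b
    by (induction b) auto
  moreover have "computable (\<lambda>x. rec_nat (f x) (\<lambda>_ r. Suc r) (g x))"
    by (intro computable_intros assms)
  ultimately show ?thesis by simp
qed

lemma computable_mult [computable_intros]:
  assumes "computable f" "computable g"
  shows "computable (\<lambda>x. f x * g x)"
proof -
  have "rec_nat 0 (\<lambda>_ r. r + a) b = a * b" for a b :: nat
    by (induction b) auto
  moreover have "computable (\<lambda>x. rec_nat 0 (\<lambda>_ r. r + f x) (g x))"
    by (intro computable_intros computable_compose[OF assms(1)] assms)
  ultimately show ?thesis by simp
qed

lemma computable_power [computable_intros]: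
  assumes "computable f" "computable g"
  shows "computable (\<lambda>x. f x ^ g x)"
proof -
  have "rec_nat 1 (\<lambda>_ r. r * a) b = a ^ b" for a b :: nat
    by (induction b) auto
  moreover have "computable (\<lambda>x. rec_nat 1 (\<lambda>_ r. r * f x) (g x))"
    by (intro computable_intros computable_compose[OF assms(1)] assms)
  ultimately show ?thesis by simp
qed

lemma computable_diff [computable_intros]:
  assumes "computable f" "computable g"
  shows "computable (\<lambda>x. f x - g x)"
proof -
  \<comment> \<open>The predecessor is the recursion that returns its own counter; truncated
    subtraction iterates it.\<close>
  have pred: "rec_nat 0 (\<lambda>n _. n) a = a - 1" for a
    by (induction a) auto
  have "rec_nat a (\<lambda>_ r. rec_nat 0 (\<lambda>n _. n) r) b = a - b" for a b
    by (induction b) (auto simp: pred)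
  moreover have "computable (\<lambda>x. rec_nat (f x) (\<lambda>_ r. rec_nat 0 (\<lambda>n _. n) r) (g x))"
    by (intro computable_intros assms)
  ultimately show ?thesis by simp
qed

section \<open>Decidable predicates and bounded quantifiers\<close>

definition computable_pred :: "(nat \<Rightarrow> bool) \<Rightarrow> bool" where
  "computable_pred P \<longleftrightarrow> computable (\<lambda>x. of_bool (P x))"

lemma computable_of_bool [computable_intros]: "computable_pred P \<Longrightarrow> computable (\<lambda>x. of_bool (P x))"
  by (simp add: computable_pred_def)

lemma computable_pred_decidable: "computable_pred P \<longleftrightarrow> decidable {x. P x}"
  by (simp add: computable_pred_def decidable_def of_bool_def)

lemma computable_pred_compose:
  "computable_pred P \<Longrightarrow> computable g \<Longrightarrow> computable_pred (\<lambda>x. P (g x))"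
  unfolding computable_pred_def by (rule computable_compose)

text \<open>A case distinction is a recursion whose length, 0 or 1, is the truth value.\<close>

lemma computable_if [computable_intros]:
  assumes "computable_pred P" "computable f" "computable g"
  shows "computable (\<lambda>x. if P x then f x else g x)"
proof -
  have "computable (\<lambda>x. rec_nat (g x) (\<lambda>_ _. f x) (of_bool (P x)))"
    by (intro computable_intros computable_compose[OF assms(2)] assms)
  moreover have "rec_nat (g x) (\<lambda>_ _. f x) (of_bool (P x)) = (if P x then f x else g x)" for x
    by simp
  ultimately show ?thesis by simp
qed

lemma computable_pred_eq_0:
  assumes "computable f"
  shows "computable_pred (\<lambda>x. f x = 0)"
proof -
  have "rec_nat (Suc 0) (\<lambda>_ _. 0) a = of_bool (a = 0)" for a
    by (cases a) auto
  moreover have "computable (\<lambda>x. rec_nat (Suc 0) (\<lambda>_ _. 0) (f x))"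
    by (intro computable_intros assms)
  ultimately show ?thesis by (simp add: computable_pred_def)
qed

lemma computable_pred_le [computable_intros]:
  assumes "computable f" "computable g"
  shows "computable_pred (\<lambda>x. f x \<le> g x)"
  using computable_pred_eq_0[OF computable_diff[OF assms]] by simp

lemma computable_pred_less [computable_intros]:
  assumes "computable f" "computable g"
  shows "computable_pred (\<lambda>x. f x < g x)"
  using computable_pred_le[OF computable_Suc assms(2), OF assms(1)] by (simp add: Suc_le_eq)

lemma computable_pred_conj [computable_intros]:
  assumes "computable_pred P" "computable_pred Q"
  shows "computable_pred (\<lambda>x. P x \<and> Q x)"
  using computable_mult[OF assms[unfolded computable_pred_def]]
  by (simp add: computable_pred_def of_bool_conj)

lemma computable_pred_not [computable_intros]:
  assumes "computable_pred P"
  shows "computable_pred (\<lambda>x. \<not> P x)"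
  using computable_pred_eq_0[OF assms[unfolded computable_pred_def]] by simp

lemma computable_pred_disj [computable_intros]:
  assumes "computable_pred P" "computable_pred Q"
  shows "computable_pred (\<lambda>x. P x \<or> Q x)"
proof -
  have "computable_pred (\<lambda>x. \<not> (\<not> P x \<and> \<not> Q x))"
    by (intro computable_intros assms)
  then show ?thesis by simp
qed

lemma computable_pred_imp [computable_intros]:
  assumes "computable_pred P" "computable_pred Q"
  shows "computable_pred (\<lambda>x. P x \<longrightarrow> Q x)"
  using computable_pred_disj[OF computable_pred_not[OF assms(1)] assms(2)] unfolding imp_conv_disj .

lemma computable_pred_eq [computable_intros]:
  assumes "computable f" "computable g"
  shows "computable_pred (\<lambda>x. f x = g x)"
proof -
  have "computable_pred (\<lambda>x. f x \<le> g x \<and> g x \<le> f x)"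
    by (intro computable_intros assms)
  then show ?thesis by (simp add: eq_iff)
qed

lemma computable_pred_bex [computable_intros]:
  assumes "computable_pred (\<lambda>z. P (pfst z) (psnd z))" "computable h"
  shows "computable_pred (\<lambda>x. \<exists>k < h x. P x k)"
proof -
  have *: "rec_nat 0 (\<lambda>k r. if r = 1 \<or> P x k then 1 else 0) n = of_bool (\<exists>k<n. P x k)" for x n
    by (induction n) (auto simp: less_Suc_eq)
  have "computable (\<lambda>z. of_bool (P (pfst z) (psnd z)))"
    using assms(1) by (simp add: computable_pred_def)
  from computable_compose[OF this, of "\<lambda>z. pair (pfst z) (pfst (psnd z))"]
  have "computable_pred (\<lambda>z. P (pfst z) (pfst (psnd z)))"
    by (simp add: computable_pred_def computable_intros)
  then have "computable (\<lambda>x. rec_nat 0 (\<lambda>k r. if r = 1 \<or> P x k then 1 else 0) (h x))"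
    by (intro computable_intros assms)
  then show ?thesis by (simp only: * computable_pred_def)
qed

lemma computable_pred_ball [computable_intros]:
  assumes "computable_pred (\<lambda>z. P (pfst z) (psnd z))" "computable h"
  shows "computable_pred (\<lambda>x. \<forall>k < h x. P x k)"
proof -
  have "computable_pred (\<lambda>x. \<not> (\<exists>k < h x. \<not> P x k))"
    by (intro computable_intros assms)
  then show ?thesis by simp
qed

section \<open>Unbounded search and division\<close>

lemma eval_Search:
  assumes "\<And>x. \<exists>t. eval p x (f x) t" "f (pair a n) = 0" "\<And>k. m \<le> k \<Longrightarrow> k < n \<Longrightarrow> f (pair a k) \<noteq> 0" "m \<le> n"
  shows "\<exists>t. eval (Search p) (pair a m) n t"
  using assms(4,3)
\<comment> \<open>The induction descends from \<open>n\<close> to \<open>m\<close>, because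
  \<open>Search_next\<close> reduces a search from \<open>k\<close> to one from
  \<open>Suc k\<close>.\<close>
proof (induction rule: inc_induct)
  case base
  then show ?case using assms(1)[of "pair a n"] assms(2) by (auto intro: eval.Search_stop)
next
  case (step k)
  then obtain t where t: "eval (Search p) (pair a (Suc k)) n t" by force
  obtain r where "f (pair a k) = Suc r" using step by (meson not0_implies_Suc le_refl)
  then show ?case using assms(1)[of "pair a k"] t by (auto intro: eval.Search_next)
qed

lemma eval_Search_0:
  assumes "\<And>x. \<exists>t. eval p x (f x) t" "f (pair a n) = 0"
  shows "\<exists>t. eval (Search p) (pair a 0) (LEAST n. f (pair a n) = 0) t"
  by (rule eval_Search[where f = f])
     (use assms in \<open>auto dest: not_less_Least intro: LeastI[of "\<lambda>n. f (pair a n) = 0"]\<close>)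

lemma computable_Least:
  assumes "computable_pred (\<lambda>z. P (pfst z) (psnd z))" "\<And>x. \<exists>n. P x n"
  shows "computable (\<lambda>x. LEAST n. P x n)"
proof -
  \<comment> \<open>\<open>Search\<close> succeeds at the value 0, so the searched program computes
    the negation of \<open>P\<close>.\<close>
  have "computable (\<lambda>z. of_bool (\<not> P (pfst z) (psnd z)))"
    by (intro computable_intros assms)
  then obtain p where p: "\<forall>z. \<exists>t. eval p z (of_bool (\<not> P (pfst z) (psnd z))) t"
    by (rule computableE)
  have "computable (\<lambda>z. LEAST n. P (pfst z) n)"
  proof (rule computableI)
    fix z
    obtain n where "P (pfst z) n" using assms(2) by blast
    then have "\<exists>t. eval (Search p) (pair (pfst z) 0) (LEAST n. P (pfst z) n) t"
      using eval_Search_0[OF p[rule_format], of "pfst z" n] by simp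
    then obtain t where "eval (Search p) (pair (pfst z) 0) (LEAST n. P (pfst z) n) t" by blast
    from eval.Comp[OF eval.Pairing[OF eval_Left eval.Zero] this]
    show "\<exists>t. eval (Comp (Search p) (Pairing Left Zero)) z (LEAST n. P (pfst z) n) t" by blast
  qed
  from computable_compose[OF this computable_pair[OF computable_ident computable_const]]
  show ?thesis by simp
qed

lemma computable_div [computable_intros]:
  assumes "computable f" "computable g" "\<And>x. g x > 0"
  shows "computable (\<lambda>x. f x div g x)"
proof -
  have *: "(LEAST q. f x < Suc q * g x) = f x div g x" for x
    by (rule Least_equality)
       (use assms(3)[of x] in \<open>auto simp: div_less_iff_less_mult less_Suc_eq_le mult.commute
          dividend_less_times_div simp flip: less_Suc_eq_le\<close>)
  have "computable (\<lambda>x. LEAST q. f x < Suc q * g x)"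
  proof (rule computable_Least)
    show "computable_pred (\<lambda>z. f (pfst z) < Suc (psnd z) * g (pfst z))"
      by (intro computable_intros computable_compose[OF assms(1)] computable_compose[OF assms(2)])
    show "\<exists>q. f x < Suc q * g x" for x
      using dividend_less_times_div[of "g x" "f x"] assms(3)[of x]
      by (intro exI[of _ "f x div g x"]) (simp add: mult.commute)
  qed
  then show ?thesis by (simp only: *)
qed

lemma computable_mod [computable_intros]:
  assumes "computable f" "computable g" "\<And>x. g x > 0"
  shows "computable (\<lambda>x. f x mod g x)"
  unfolding modulo_nat_def by (intro computable_intros assms)

lemma computable_pred_dvd [computable_intros]:
  assumes "computable f" "computable g"
  shows "computable_pred (\<lambda>x. f x dvd g x)"
proof -
  \<comment> \<open>The cofactor is at most \<open>b\<close> if \<open>b > 0\<close>, and for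
    \<open>b = 0\<close> the cofactor 0 serves.\<close>
  have *: "a dvd b \<longleftrightarrow> (\<exists>k < Suc b. b = a * k)" for a b :: nat
    by (cases "b = 0") (auto simp: dvd_def less_Suc_eq_le)
  show ?thesis unfolding *
    by (intro computable_intros computable_compose[OF assms(1)] computable_compose[OF assms(2)] assms)
qed

section \<open>A universal machine\<close>

lemma prog_encode_inject [simp]: "prog_encode p = prog_encode q \<longleftrightarrow> p = q"
proof (induction p arbitrary: q)
  case Zero then show ?case by (cases q) auto
next
  case Succ then show ?case by (cases q) auto
next
  case Left then show ?case by (cases q) auto
next
  case Right then show ?case by (cases q) auto
next
  case (Pairing f g) then show ?case by (cases q) (auto, presburger+)
next
  case (Comp f g) then show ?case by (cases q) (auto, presburger+)
next
  case (PrimRec f g) then show ?case by (cases q) (auto, presburger+)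
next
  case (Search f) then show ?case by (cases q) (auto, presburger+)
qed

text \<open>From 4 on, the residue modulo 4 selects a composite constructor and the quotient minus
  one holds smaller codes. This lets every index \<open>i\<close> be treated as the code of a
  program when the machine is compared with \<open>re_at i\<close>.\<close>

lemma prog_encode_surj: "\<exists>p. prog_encode p = i"
proof (induction i rule: less_induct)
  case (less i)
  show ?case
  proof (cases "i < 4")
    case True
    then have "i = 0 \<or> i = 1 \<or> i = 2 \<or> i = 3" by auto
    then show ?thesis using prog_encode.simps(1-4) by metis
  next
    case False
    define k where "k = i div 4 - 1"
    have i: "i = 4 + i mod 4 + 4 * k" using False unfolding k_def by presburger
    obtain f where f: "prog_encode f = pfst k" using less.IH[of "pfst k"] pfst_le[of k] i by auto
    obtain g where g: "prog_encode g = psnd k" using less.IH[of "psnd k"] psnd_le[of k] i by auto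
    obtain h where h: "prog_encode h = k" using less.IH[of k] i by auto
    have "i mod 4 < 4" by simp
    then consider "i mod 4 = 0" | "i mod 4 = 1" | "i mod 4 = 2" | "i mod 4 = 3" by linarith
    then show ?thesis
    proof cases
      case 1 then have "prog_encode (Pairing f g) = i" using i by (simp add: f g)
      then show ?thesis ..
    next
      case 2 then have "prog_encode (Comp f g) = i" using i by (simp add: f g)
      then show ?thesis ..
    next
      case 3 then have "prog_encode (PrimRec f g) = i" using i by (simp add: f g)
      then show ?thesis ..
    next
      case 4 then have "prog_encode (Search h) = i" using i by (simp add: h)
      then show ?thesis ..
    qed
  qed
qed

definition quad :: "nat \<Rightarrow> nat \<Rightarrow> nat \<Rightarrow> nat \<Rightarrow> nat" where
  "quad a b c d = pair a (pair b (pair c d))"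

definition "quad0 n = pfst n"
definition "quad1 n = pfst (psnd n)"
definition "quad2 n = pfst (psnd (psnd n))"
definition "quad3 n = psnd (psnd (psnd n))"

lemmas quad_sel_defs = quad0_def quad1_def quad2_def quad3_def

lemma quad_sel [simp]:
  "quad0 (quad a b c d) = a" "quad1 (quad a b c d) = b"
  "quad2 (quad a b c d) = c" "quad3 (quad a b c d) = d"
  by (simp_all add: quad_def quad_sel_defs)

lemma quad_surj [simp]: "quad (quad0 s) (quad1 s) (quad2 s) (quad3 s) = s"
  by (simp add: quad_def quad_sel_defs)

lemma quad_inject [simp]:
  "quad a b c d = quad a' b' c' d' \<longleftrightarrow> a = a' \<and> b = b' \<and> c = c' \<and> d = d'"
  by (auto simp: quad_def)

text \<open>The empty stack 0 is the quadruple of zeros, so its tag reads 0, the halting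
  case.\<close>

lemma quad_0_sel [simp]: "quad0 0 = 0" "quad1 0 = 0" "quad2 0 = 0" "quad3 0 = 0"
  using quad_sel[of 0 0 0 0] by (simp_all add: quad_def)

lemma quad_eq_0 [simp]: "quad a b c d = 0 \<longleftrightarrow> a = 0 \<and> b = 0 \<and> c = 0 \<and> d = 0"
  using quad_inject[of a b c d 0 0 0 0] by (simp add: quad_def)

text \<open>Subtracting 1 undoes the offset 4 that \<open>prog_encode\<close> adds to composite
  codes.\<close>

definition "code1 i = pfst (i div 4 - 1)"
definition "code2 i = psnd (i div 4 - 1)"

text \<open>
  A state \<open>quad m x K c\<close> of the machine is about to run the program with code \<open>m - 1\<close> on \<open>x\<close>,
  or, if \<open>m = 0\<close>, to return the value \<open>x\<close> to the stack \<open>K\<close>. The counter \<open>c\<close> is the number of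
  rule applications so far. A stack is \<open>0\<close> or has the form \<open>quad tag d e K\<close> with \<open>tag > 0\<close>.
\<close>

definition eval_step :: "nat \<Rightarrow> nat \<Rightarrow> nat \<Rightarrow> nat \<Rightarrow> nat" where
  "eval_step i x K c =
    (if i = 0 then quad 0 0 K c
     else if i = 1 then quad 0 (Suc x) K c
     else if i = 2 then quad 0 (pfst x) K c
     else if i = 3 then quad 0 (psnd x) K c
     else if i mod 4 = 0 then quad (Suc (code1 i)) x (quad 1 (code2 i) x K) c
     else if i mod 4 = 1 then quad (Suc (code2 i)) x (quad 3 (code1 i) 0 K) c
     else if i mod 4 = 2 then
       (if psnd x = 0 then quad (Suc (code1 i)) (pfst x) K c
        else quad (Suc i) (pair (pfst x) (psnd x - 1))
               (quad 4 (code2 i) (pair (pfst x) (psnd x - 1)) K) c)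
     else quad (Suc (i div 4 - 1)) x (quad 5 i x K) c)"

text \<open>The tags record what remains to be done: 1 and 2 the second component and then the
  assembly of a \<open>Pairing\<close>, 3 the outer program of a \<open>Comp\<close>, 4 the step
  program of a \<open>PrimRec\<close>, 5 the test of a value in a \<open>Search\<close>. Tag 0 is
  the empty stack, where the state no longer changes.\<close>

definition return_step :: "nat \<Rightarrow> nat \<Rightarrow> nat \<Rightarrow> nat" where
  "return_step y K c =
    (if quad0 K = 0 then quad 0 y K c
     else if quad0 K = 1 then quad (Suc (quad1 K)) (quad2 K) (quad 2 y 0 (quad3 K)) c
     else if quad0 K = 2 then quad 0 (pair (quad1 K) y) (quad3 K) c
     else if quad0 K = 3 then quad (Suc (quad1 K)) y (quad3 K) c
     else if quad0 K = 4 then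
       quad (Suc (quad1 K)) (pair (pfst (quad2 K)) (pair (psnd (quad2 K)) y)) (quad3 K) c
     else if y = 0 then quad 0 (psnd (quad2 K)) (quad3 K) c
     else quad (Suc (quad1 K)) (pair (pfst (quad2 K)) (Suc (psnd (quad2 K)))) (quad3 K) c)"

text \<open>Each application of an \<open>eval\<close> rule starts exactly one program, while
  returns to the stack are not counted. So the final counter is the exact step number of
  \<open>eval\<close>.\<close>

definition step :: "nat \<Rightarrow> nat" where
  "step s = (if quad0 s = 0 then return_step (quad1 s) (quad2 s) (quad3 s)
     else eval_step (quad0 s - 1) (quad1 s) (quad2 s) (Suc (quad3 s)))"

lemma computable_quad [computable_intros]:
  assumes "computable f" "computable g" "computable h" "computable k"
  shows "computable (\<lambda>x. quad (f x) (g x) (h x) (k x))"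
  unfolding quad_def by (intro computable_intros assms)

lemma computable_quad_sel [computable_intros]:
  assumes "computable f"
  shows "computable (\<lambda>x. quad0 (f x))" "computable (\<lambda>x. quad1 (f x))"
    "computable (\<lambda>x. quad2 (f x))" "computable (\<lambda>x. quad3 (f x))"
  unfolding quad_sel_defs by (intro computable_intros assms)+

lemma computable_step [computable_intros]:
  assumes "computable f"
  shows "computable (\<lambda>x. step (f x))"
proof -
  have "computable step"
    unfolding step_def return_step_def eval_step_def code1_def code2_def
    by (intro computable_intros) auto
  then show ?thesis using assms by (rule computable_compose)
qed

lemma mod_div_4:
  "(4 + 4 * k) mod 4 = (0 :: nat)" "(5 + 4 * k) mod 4 = (1 :: nat)"
  "(6 + 4 * k) mod 4 = (2 :: nat)" "(7 + 4 * k) mod 4 = (3 :: nat)"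
  "(4 + 4 * k) div 4 = Suc k" "(5 + 4 * k) div 4 = Suc k"
  "(6 + 4 * k) div 4 = Suc k" "(7 + 4 * k) div 4 = Suc k" for k :: nat
  by presburger+

abbreviation run :: "prog \<Rightarrow> nat \<Rightarrow> nat \<Rightarrow> nat \<Rightarrow> nat" where
  "run p \<equiv> quad (Suc (prog_encode p))"

lemma step_run [simp]:
  "step (run Zero x K c) = quad 0 0 K (Suc c)"
  "step (run Succ x K c) = quad 0 (Suc x) K (Suc c)"
  "step (run Left x K c) = quad 0 (pfst x) K (Suc c)"
  "step (run Right x K c) = quad 0 (psnd x) K (Suc c)"
  "step (run (Pairing f g) x K c) = run f x (quad 1 (prog_encode g) x K) (Suc c)"
  "step (run (Comp f g) x K c) = run g x (quad 3 (prog_encode f) 0 K) (Suc c)"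
  "step (run (PrimRec f g) (pair a 0) K c) = run f a K (Suc c)"
  "step (run (PrimRec f g) (pair a (Suc n)) K c) =
     run (PrimRec f g) (pair a n) (quad 4 (prog_encode g) (pair a n) K) (Suc c)"
  "step (run (Search f) x K c) = run f x (quad 5 (prog_encode (Search f)) x K) (Suc c)"
  by (simp_all add: step_def eval_step_def code1_def code2_def mod_div_4)

lemma step_return [simp]:
  "step (quad 0 y 0 c) = quad 0 y 0 c"
  "step (quad 0 y (quad (Suc 0) j x K) c) = quad (Suc j) x (quad 2 y 0 K) c"
  "step (quad 0 y (quad 2 z e K) c) = quad 0 (pair z y) K c"
  "step (quad 0 y (quad 3 j e K) c) = quad (Suc j) y K c"
  "step (quad 0 y (quad 4 j (pair a n) K) c) = quad (Suc j) (pair a (pair n y)) K c"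
  "step (quad 0 0 (quad 5 j (pair a n) K) c) = quad 0 n K c"
  "step (quad 0 (Suc y) (quad 5 j (pair a n) K) c) = quad (Suc j) (pair a (Suc n)) K c"
  by (simp_all add: step_def return_step_def)

section \<open>Correctness of the machine and decidability of the stages of r.e. sets\<close>

lemma funpow_step_trans: "(f ^^ k) s = t \<Longrightarrow> (f ^^ l) t = v \<Longrightarrow> (f ^^ (k + l)) s = v"
  by (simp add: funpow_add add.commute[of k l])

lemma funpow_step_Suc: "(f ^^ k) (f s) = t \<Longrightarrow> (f ^^ Suc k) s = t"
  by (simp add: funpow_swap1)

text \<open>The factor 3 is the worst case, met by \<open>Pairing\<close>: one start and two returns
  for a single rule application. Stack and counter are arbitrary so that runs of subprograms can be
  chained.\<close>

lemma machine_complete: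
  "eval p x y u \<Longrightarrow> \<exists>k \<le> 3 * u. (step ^^ k) (run p x K c) = quad 0 y K (c + u)"
proof (induction arbitrary: K c rule: eval.induct)
  case (Pairing f x y s g z t)
  let ?K = "quad 1 (prog_encode g) x K" and ?L = "quad 2 y 0 K"
  obtain k where k: "k \<le> 3 * s" "(step ^^ k) (run f x ?K (Suc c)) = quad 0 y ?K (Suc c + s)"
    using Pairing.IH(1) by blast
  obtain l where l: "l \<le> 3 * t" "(step ^^ l) (run g x ?L (Suc c + s)) = quad 0 z ?L (Suc c + s + t)"
    using Pairing.IH(2) by blast
  have "(step ^^ (l + 1)) (run g x ?L (Suc c + s)) = quad 0 (pair y z) K (c + Suc (s + t))"
    by (rule funpow_step_trans[OF l(2)]) simp
  then have "(step ^^ Suc (k + Suc (l + 1))) (run (Pairing f g) x K c) = quad 0 (pair y z) K (c + Suc (s + t))"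
    by (intro funpow_step_Suc funpow_step_trans[where k = k])
       (use k in \<open>auto intro!: funpow_step_Suc simp del: prog_encode.simps\<close>)
  then show ?case using k(1) l(1) by (intro exI[of _ "Suc (k + Suc (l + 1))"]) auto
next
  case (Comp g x y s f z t)
  let ?K = "quad 3 (prog_encode f) 0 K"
  obtain k where k: "k \<le> 3 * s" "(step ^^ k) (run g x ?K (Suc c)) = quad 0 y ?K (Suc c + s)"
    using Comp.IH(1) by blast
  obtain l where l: "l \<le> 3 * t" "(step ^^ l) (run f y K (Suc c + s)) = quad 0 z K (Suc c + s + t)"
    using Comp.IH(2) by blast
  have "(step ^^ Suc (k + Suc l)) (run (Comp f g) x K c) = quad 0 z K (c + Suc (s + t))"
    by (intro funpow_step_Suc funpow_step_trans[where k = k])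
       (use k l in \<open>auto intro!: funpow_step_Suc simp del: prog_encode.simps\<close>)
  then show ?case using k(1) l(1) by (intro exI[of _ "Suc (k + Suc l)"]) auto
next
  case (PrimRec_0 f a y t g)
  obtain k where k: "k \<le> 3 * t" "(step ^^ k) (run f a K (Suc c)) = quad 0 y K (Suc c + t)"
    using PrimRec_0.IH by blast
  then have "(step ^^ Suc k) (run (PrimRec f g) (pair a 0) K c) = quad 0 y K (c + Suc t)"
    by (intro funpow_step_Suc) (auto simp del: prog_encode.simps)
  then show ?case using k(1) by (intro exI[of _ "Suc k"]) auto
next
  case (PrimRec_Suc f g a n r s y t)
  let ?K = "quad 4 (prog_encode g) (pair a n) K"
  obtain k where k: "k \<le> 3 * s"
    "(step ^^ k) (run (PrimRec f g) (pair a n) ?K (Suc c)) = quad 0 r ?K (Suc c + s)"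
    using PrimRec_Suc.IH(1) by blast
  obtain l where l: "l \<le> 3 * t"
    "(step ^^ l) (run g (pair a (pair n r)) K (Suc c + s)) = quad 0 y K (Suc c + s + t)"
    using PrimRec_Suc.IH(2) by blast
  have "(step ^^ Suc (k + Suc l)) (run (PrimRec f g) (pair a (Suc n)) K c) = quad 0 y K (c + Suc (s + t))"
    by (intro funpow_step_Suc funpow_step_trans[where k = k])
       (use k l in \<open>auto intro!: funpow_step_Suc simp del: prog_encode.simps\<close>)
  then show ?case using k(1) l(1) by (intro exI[of _ "Suc (k + Suc l)"]) auto
next
  case (Search_stop f a m t)
  let ?K = "quad 5 (prog_encode (Search f)) (pair a m) K"
  obtain k where k: "k \<le> 3 * t"
    "(step ^^ k) (run f (pair a m) ?K (Suc c)) = quad 0 0 ?K (Suc c + t)"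
    using Search_stop.IH by blast
  have "(step ^^ Suc (k + 1)) (run (Search f) (pair a m) K c) = quad 0 m K (c + Suc t)"
    by (intro funpow_step_Suc funpow_step_trans[where k = k])
       (use k in \<open>auto simp del: prog_encode.simps\<close>)
  then show ?case using k(1) by (intro exI[of _ "Suc (k + 1)"]) auto
next
  case (Search_next f a m r s n t)
  let ?K = "quad 5 (prog_encode (Search f)) (pair a m) K"
  obtain k where k: "k \<le> 3 * s"
    "(step ^^ k) (run f (pair a m) ?K (Suc c)) = quad 0 (Suc r) ?K (Suc c + s)"
    using Search_next.IH(1) by blast
  obtain l where l: "l \<le> 3 * t"
    "(step ^^ l) (run (Search f) (pair a (Suc m)) K (Suc c + s)) = quad 0 n K (Suc c + s + t)"
    using Search_next.IH(2) by blast
  have "(step ^^ Suc (k + Suc l)) (run (Search f) (pair a m) K c) = quad 0 n K (c + Suc (s + t))"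
    by (intro funpow_step_Suc funpow_step_trans[where k = k])
       (use k l in \<open>auto intro!: funpow_step_Suc simp del: prog_encode.simps\<close>)
  then show ?case using k(1) l(1) by (intro exI[of _ "Suc (k + Suc l)"]) auto
qed (auto intro!: exI[of _ 1] simp del: prog_encode.simps)

lemma funpow_step_cases:
  assumes "(f ^^ k) s = t" "s \<noteq> t"
  obtains l where "k = Suc l" "(f ^^ l) (f s) = t"
  using assms by (cases k) (auto simp: funpow_swap1)

text \<open>A run that halts with empty stack must first return a value to the stack
  \<open>K\<close> it began with. The remaining run is strictly shorter, so induction on the number
  of steps treats the subprograms one after another, including the recursive calls of
  \<open>PrimRec\<close> and the restarts of \<open>Search\<close>.\<close>

lemma machine_sound:
  assumes "(step ^^ k) (run p x K c) = quad 0 y 0 d"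
  shows "\<exists>z u l. l < k \<and> eval p x z u \<and> (step ^^ l) (quad 0 z K (c + u)) = quad 0 y 0 d"
  using assms
proof (induction k arbitrary: p x K c rule: less_induct)
  case (less k)
  let ?H = "quad 0 y 0 d"
  obtain k0 where k: "k = Suc k0" and k0: "(step ^^ k0) (step (run p x K c)) = ?H"
    using less.prems by (rule funpow_step_cases) auto
  obtain a m where x: "x = pair a m" by (metis pair_pfst_psnd)
  note [simp del] = prog_encode.simps
  show ?case
  proof (cases p)
    case Zero
    then show ?thesis using k k0 eval.Zero[of x] by (intro exI[of _ 0] exI[of _ 1] exI[of _ k0]) auto
  next
    case Succ
    then show ?thesis using k k0 eval.Succ[of x] by (intro exI[of _ "Suc x"] exI[of _ 1] exI[of _ k0]) auto
  next
    case Left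
    then show ?thesis using k k0 eval_Left[of x] by (intro exI[of _ "pfst x"] exI[of _ 1] exI[of _ k0]) auto
  next
    case Right
    then show ?thesis using k k0 eval_Right[of x] by (intro exI[of _ "psnd x"] exI[of _ 1] exI[of _ k0]) auto
  next
    case (Pairing f g)
    let ?K = "quad 1 (prog_encode g) x K"
    have "(step ^^ k0) (run f x ?K (Suc c)) = ?H" using k0 Pairing by simp
    then obtain v s l where 1: "l < k0" "eval f x v s" "(step ^^ l) (quad 0 v ?K (Suc c + s)) = ?H"
      using less.IH[of k0] k by blast
    \<comment> \<open>The stack still holds a frame, so the machine has not halted and takes a
      further step, which acts on that frame.\<close>
    from 1(3) obtain l' where l': "l = Suc l'" "(step ^^ l') (step (quad 0 v ?K (Suc c + s))) = ?H"
      by (rule funpow_step_cases) auto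
    then have "(step ^^ l') (run g x (quad 2 v 0 K) (Suc c + s)) = ?H" by simp
    then obtain w t j where 2: "j < l'" "eval g x w t"
        "(step ^^ j) (quad 0 w (quad 2 v 0 K) (Suc c + s + t)) = ?H"
      using less.IH[of l'] 1(1) l' k by (meson Suc_lessD less_SucI less_trans)
    from 2(3) obtain j' where "j = Suc j'" "(step ^^ j') (step (quad 0 w (quad 2 v 0 K) (Suc c + s + t))) = ?H"
      by (rule funpow_step_cases) auto
    then show ?thesis using 1 2 l' k Pairing eval.Pairing[OF 1(2) 2(2)]
      by (intro exI[of _ "pair v w"] exI[of _ "Suc (s + t)"] exI[of _ j']) (auto simp: add.assoc)
  next
    case (Comp f g)
    let ?K = "quad 3 (prog_encode f) 0 K"
    have "(step ^^ k0) (run g x ?K (Suc c)) = ?H" using k0 Comp by simp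
    then obtain v s l where 1: "l < k0" "eval g x v s" "(step ^^ l) (quad 0 v ?K (Suc c + s)) = ?H"
      using less.IH[of k0] k by blast
    from 1(3) obtain l' where l': "l = Suc l'" "(step ^^ l') (step (quad 0 v ?K (Suc c + s))) = ?H"
      by (rule funpow_step_cases) auto
    then have "(step ^^ l') (run f v K (Suc c + s)) = ?H" by simp
    then obtain w t j where 2: "j < l'" "eval f v w t" "(step ^^ j) (quad 0 w K (Suc c + s + t)) = ?H"
      using less.IH[of l'] 1(1) l' k by (meson Suc_lessD less_SucI less_trans)
    then show ?thesis using 1 l' k Comp eval.Comp[OF 1(2) 2(2)]
      by (intro exI[of _ w] exI[of _ "Suc (s + t)"] exI[of _ j]) (auto simp: add.assoc)
  next
    case (PrimRec f g)
    show ?thesis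
    proof (cases m)
      case 0
      then have "(step ^^ k0) (run f a K (Suc c)) = ?H" using k0 PrimRec x by simp
      then obtain v s l where 1: "l < k0" "eval f a v s" "(step ^^ l) (quad 0 v K (Suc c + s)) = ?H"
        using less.IH[of k0] k by blast
      then show ?thesis using k PrimRec 0 x eval.PrimRec_0[OF 1(2)]
        by (intro exI[of _ v] exI[of _ "Suc s"] exI[of _ l]) auto
    next
      case (Suc n)
      let ?K = "quad 4 (prog_encode g) (pair a n) K"
      have "(step ^^ k0) (run p (pair a n) ?K (Suc c)) = ?H" using k0 PrimRec x Suc by simp
      then obtain v s l where 1: "l < k0" "eval p (pair a n) v s" "(step ^^ l) (quad 0 v ?K (Suc c + s)) = ?H"
        using less.IH[of k0] k by blast
      from 1(3) obtain l' where l': "l = Suc l'" "(step ^^ l') (step (quad 0 v ?K (Suc c + s))) = ?H"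
        by (rule funpow_step_cases) auto
      then have "(step ^^ l') (run g (pair a (pair n v)) K (Suc c + s)) = ?H" by simp
      then obtain w t j where 2: "j < l'" "eval g (pair a (pair n v)) w t"
          "(step ^^ j) (quad 0 w K (Suc c + s + t)) = ?H"
        using less.IH[of l'] 1(1) l' k by (meson Suc_lessD less_SucI less_trans)
      then show ?thesis using 1 l' k PrimRec x Suc eval.PrimRec_Suc[OF 1(2)[unfolded PrimRec] 2(2)]
        by (intro exI[of _ w] exI[of _ "Suc (s + t)"] exI[of _ j]) (auto simp: add.assoc)
    qed
  next
    case (Search f)
    let ?K = "quad 5 (prog_encode p) x K"
    have "(step ^^ k0) (run f x ?K (Suc c)) = ?H" using k0 Search by simp
    then obtain v s l where 1: "l < k0" "eval f x v s" "(step ^^ l) (quad 0 v ?K (Suc c + s)) = ?H"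
      using less.IH[of k0] k by blast
    from 1(3) obtain l' where l': "l = Suc l'" "(step ^^ l') (step (quad 0 v ?K (Suc c + s))) = ?H"
      by (rule funpow_step_cases) auto
    show ?thesis
    proof (cases v)
      case 0
      then show ?thesis using 1 l' k Search x eval.Search_stop[OF 1(2)[unfolded x 0]]
        by (intro exI[of _ m] exI[of _ "Suc s"] exI[of _ l']) auto
    next
      case (Suc r)
      then have "(step ^^ l') (run p (pair a (Suc m)) K (Suc c + s)) = ?H" using l' x by simp
      then obtain w t j where 2: "j < l'" "eval p (pair a (Suc m)) w t"
          "(step ^^ j) (quad 0 w K (Suc c + s + t)) = ?H"
        using less.IH[of l'] 1(1) l' k by (meson Suc_lessD less_SucI less_trans)
      then show ?thesis
        using 1 l' k Search x eval.Search_next[OF 1(2)[unfolded x Suc] 2(2)[unfolded Search]]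
        by (intro exI[of _ w] exI[of _ "Suc (s + t)"] exI[of _ j]) (auto simp: add.assoc)
    qed
  qed
qed

lemma funpow_fixpoint: "f s = s \<Longrightarrow> (f ^^ k) s = s"
  by (induction k) auto

text \<open>By \<open>machine_complete\<close>, \<open>3 * t\<close> machine steps suffice for any
  computation of at most \<open>t\<close> rule applications.\<close>

definition halt_state :: "nat \<Rightarrow> nat \<Rightarrow> nat \<Rightarrow> nat" where
  "halt_state i x t = rec_nat (quad (Suc i) x 0 0) (\<lambda>_. step) (3 * t)"

lemma halt_state_funpow: "halt_state (prog_encode p) x t = (step ^^ (3 * t)) (run p x 0 0)"
proof -
  have "rec_nat s (\<lambda>_. step) n = (step ^^ n) s" for s n
    by (induction n) auto
  then show ?thesis by (simp add: halt_state_def)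
qed

text \<open>Halted states are fixed points, so running longer does no damage. But
  \<open>3 * t\<close> machine steps can contain more than \<open>t\<close> rule applications, which
  the test on the counter excludes.\<close>

lemma re_at_iff:
  "x \<in> re_at i t \<longleftrightarrow> quad0 (halt_state i x t) = 0 \<and> quad2 (halt_state i x t) = 0 \<and> quad3 (halt_state i x t) \<le> t"
  (is "_ \<longleftrightarrow> ?R")
proof -
  obtain p where i: "i = prog_encode p" using prog_encode_surj by metis
  show ?thesis
  proof
    assume "x \<in> re_at i t"
    then obtain y u where u: "u \<le> t" "eval p x y u" by (auto simp: re_at_def i)
    then obtain k where k: "k \<le> 3 * u" "(step ^^ k) (run p x 0 0) = quad 0 y 0 u"
      using machine_complete[of p x y u 0 0] by auto
    have "(step ^^ (k + (3 * t - k))) (run p x 0 0) = quad 0 y 0 u"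
      by (rule funpow_step_trans[OF k(2)]) (simp add: funpow_fixpoint)
    moreover have "k + (3 * t - k) = 3 * t" using k u by simp
    ultimately show ?R unfolding i halt_state_funpow using u by simp
  next
    assume ?R
    then obtain y d where "halt_state i x t = quad 0 y 0 d" and d: "d \<le> t"
      by (metis quad_surj)
    then have "(step ^^ (3 * t)) (run p x 0 0) = quad 0 y 0 d" by (simp add: i halt_state_funpow)
    from machine_sound[OF this] obtain z u l
      where "eval p x z u" "(step ^^ l) (quad 0 z 0 u) = quad 0 y 0 d" by auto
    then have "eval p x z d" by (simp add: funpow_fixpoint)
    then show "x \<in> re_at i t" using d by (auto simp: re_at_def i)
  qed
qed

lemma computable_pred_re_at [computable_intros]:
  assumes "computable f" "computable g" "computable h"
  shows "computable_pred (\<lambda>x. f x \<in> re_at (g x) (h x))"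
proof -
  have "computable (\<lambda>x. halt_state (g x) (f x) (h x))"
    unfolding halt_state_def by (intro computable_intros assms)
  then show ?thesis unfolding re_at_iff by (intro computable_intros assms)
qed

lemma computable_pred_W_at [computable_intros]:
  assumes "computable f" "computable g" "computable h" "computable k"
  shows "computable_pred (\<lambda>x. (f x, g x) \<in> W_at (h x) (k x))"
proof -
  have *: "(a, b) \<in> W_at i t \<longleftrightarrow> (\<exists>z < Suc t. b \<le> z \<and> pair a z \<in> re_at i t)" for a b i t
    by (auto simp: W_at_def less_Suc_eq_le)
  show ?thesis unfolding *
    by (intro computable_intros assms assms[THEN computable_compose])
qed

section \<open>Computable functions into the rationals\<close>

text \<open>Together with \<open>int_neg\<close> this splits \<open>int_decode e\<close> into
  positive and negative part, so that signed arithmetic takes place in the natural numbers.\<close>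

definition int_pos :: "nat \<Rightarrow> nat" where "int_pos e = (if 2 dvd e then e div 2 else 0)"
definition int_neg :: "nat \<Rightarrow> nat" where "int_neg e = (if 2 dvd e then 0 else Suc (e div 2))"

lemma int_decode_pos_neg: "int_decode e = int (int_pos e) - int (int_neg e)"
  and abs_int_decode: "\<bar>int_decode e\<bar> = int (int_pos e + int_neg e)"
  by (auto simp: int_decode_def sum_decode_def int_pos_def int_neg_def)

lemma computable_int_pos [computable_intros]: "computable f \<Longrightarrow> computable (\<lambda>x. int_pos (f x))"
  and computable_int_neg [computable_intros]: "computable f \<Longrightarrow> computable (\<lambda>x. int_neg (f x))"
  unfolding int_pos_def int_neg_def by (intro computable_intros; simp)+

text \<open>Fractions may be unreduced and the sign is split into a difference, so sums and products
  are polynomials in natural numbers. Reduction is postponed to the passage to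
  \<open>computable_to_rat\<close>.\<close>

definition computable_rat :: "(nat \<Rightarrow> rat) \<Rightarrow> bool" where
  "computable_rat f \<longleftrightarrow> (\<exists>P N D. computable P \<and> computable N \<and> computable D \<and>
     (\<forall>x. D x > 0 \<and> f x = (of_nat (P x) - of_nat (N x)) / of_nat (D x)))"

lemma computable_ratI:
  assumes "computable P" "computable N" "computable D"
    and "\<And>x. D x > 0" "\<And>x. f x = (of_nat (P x) - of_nat (N x)) / of_nat (D x)"
  shows "computable_rat f"
  using assms unfolding computable_rat_def by blast

lemma computable_ratE:
  assumes "computable_rat f"
  obtains P N D where "computable P" "computable N" "computable D"
    and "\<And>x. D x > 0" "\<And>x. f x = (of_nat (P x) - of_nat (N x)) / of_nat (D x)"
  using assms unfolding computable_rat_def by blast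

lemma computable_rat_compose:
  assumes "computable_rat f" "computable g"
  shows "computable_rat (\<lambda>x. f (g x))"
proof -
  obtain P N D where *: "computable P" "computable N" "computable D"
    "\<And>x. D x > 0" "\<And>x. f x = (of_nat (P x) - of_nat (N x)) / of_nat (D x)"
    using assms(1) by (rule computable_ratE) blast
  show ?thesis
    by (rule computable_ratI[OF *(1-3)[THEN computable_compose, OF assms(2)]]) (simp_all add: *)
qed

lemma computable_rat_of_nat [computable_intros]:
  assumes "computable f"
  shows "computable_rat (\<lambda>x. of_nat (f x))"
  by (rule computable_ratI[OF assms computable_const[of 0] computable_const[of 1]]) auto

lemma computable_rat_const [computable_intros]:
  "computable_rat (\<lambda>x. 0)" "computable_rat (\<lambda>x. 1)"
  using computable_rat_of_nat[OF computable_const[of 0]]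
    computable_rat_of_nat[OF computable_const[of 1]] by simp_all

lemma computable_rat_inverse_of_nat [computable_intros]:
  assumes "computable f"
  shows "computable_rat (\<lambda>x. 1 / of_nat (f x))"
proof (rule computable_ratI)
  \<comment> \<open>For \<open>f x = 0\<close> the fraction 0/1 matches the convention
    \<open>1 / 0 = 0\<close>.\<close>
  show "computable (\<lambda>x. if f x = 0 then 0 else 1)" "computable (\<lambda>_. 0)"
    "computable (\<lambda>x. if f x = 0 then 1 else f x)"
    by (intro computable_intros assms)+
qed auto

lemma computable_rat_of_int_decode [computable_intros]:
  assumes "computable f"
  shows "computable_rat (\<lambda>x. of_int (int_decode (f x)))"
  by (rule computable_ratI[OF computable_int_pos computable_int_neg computable_const[of 1]])
     (simp_all add: assms int_decode_pos_neg)

lemma computable_rat_if [computable_intros]: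
  assumes "computable_pred Q" "computable_rat f" "computable_rat g"
  shows "computable_rat (\<lambda>x. if Q x then f x else g x)"
proof -
  obtain P N D where f: "computable P" "computable N" "computable D"
    "\<And>x. D x > 0" "\<And>x. f x = (of_nat (P x) - of_nat (N x)) / of_nat (D x)"
    using assms(2) by (rule computable_ratE) blast
  obtain P' N' D' where g: "computable P'" "computable N'" "computable D'"
    "\<And>x. D' x > 0" "\<And>x. g x = (of_nat (P' x) - of_nat (N' x)) / of_nat (D' x)"
    using assms(3) by (rule computable_ratE) blast
  show ?thesis
  proof (rule computable_ratI)
    show "computable (\<lambda>x. if Q x then P x else P' x)" "computable (\<lambda>x. if Q x then N x else N' x)"
      "computable (\<lambda>x. if Q x then D x else D' x)"
      by (intro computable_intros assms f(1-3) g(1-3))+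
  qed (auto simp: f(4,5) g(4,5))
qed

lemma rat_add_frac:
  "(p - n) / d + (p' - n') / d' = ((p * d' + p' * d) - (n * d' + n' * d)) / (d * d')"
  if "d \<noteq> 0" "d' \<noteq> 0" for p n d p' n' d' :: rat
  using that by (simp add: field_simps)

lemma rat_mult_frac:
  "(p - n) / d * ((p' - n') / d') = ((p * p' + n * n') - (p * n' + n * p')) / (d * d')"
  for p n d p' n' d' :: rat
  by (simp add: algebra_simps)

lemma computable_rat_mult [computable_intros]:
  assumes "computable_rat f" "computable_rat g"
  shows "computable_rat (\<lambda>x. f x * g x)"
proof -
  obtain P N D where f: "computable P" "computable N" "computable D"
    "\<And>x. D x > 0" "\<And>x. f x = (of_nat (P x) - of_nat (N x)) / of_nat (D x)"
    using assms(1) by (rule computable_ratE) blast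
  obtain P' N' D' where g: "computable P'" "computable N'" "computable D'"
    "\<And>x. D' x > 0" "\<And>x. g x = (of_nat (P' x) - of_nat (N' x)) / of_nat (D' x)"
    using assms(2) by (rule computable_ratE) blast
  show ?thesis
  proof (rule computable_ratI)
    show "computable (\<lambda>x. P x * P' x + N x * N' x)" "computable (\<lambda>x. P x * N' x + N x * P' x)"
      "computable (\<lambda>x. D x * D' x)"
      by (intro computable_intros f(1-3) g(1-3))+
    show "0 < D x * D' x" for x using f(4) g(4) by simp
  qed (simp only: f(5) g(5) rat_mult_frac of_nat_add of_nat_mult)
qed

lemma computable_rat_add [computable_intros]:
  assumes "computable_rat f" "computable_rat g"
  shows "computable_rat (\<lambda>x. f x + g x)"
proof -
  obtain P N D where f: "computable P" "computable N" "computable D"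
    "\<And>x. D x > 0" "\<And>x. f x = (of_nat (P x) - of_nat (N x)) / of_nat (D x)"
    using assms(1) by (rule computable_ratE) blast
  obtain P' N' D' where g: "computable P'" "computable N'" "computable D'"
    "\<And>x. D' x > 0" "\<And>x. g x = (of_nat (P' x) - of_nat (N' x)) / of_nat (D' x)"
    using assms(2) by (rule computable_ratE) blast
  show ?thesis
  proof (rule computable_ratI)
    show "computable (\<lambda>x. P x * D' x + P' x * D x)" "computable (\<lambda>x. N x * D' x + N' x * D x)"
      "computable (\<lambda>x. D x * D' x)"
      by (intro computable_intros f(1-3) g(1-3))+
  qed (use f(4) g(4) in \<open>auto simp: f(5) g(5) rat_add_frac less_imp_neq[symmetric]\<close>)
qed

lemma computable_rat_uminus [computable_intros]:
  assumes "computable_rat f"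
  shows "computable_rat (\<lambda>x. - f x)"
proof -
  obtain P N D where f: "computable P" "computable N" "computable D"
    "\<And>x. D x > 0" "\<And>x. f x = (of_nat (P x) - of_nat (N x)) / of_nat (D x)"
    using assms by (rule computable_ratE) blast
  show ?thesis
    by (rule computable_ratI[OF f(2,1,3,4)]) (auto simp: f(5) minus_divide_left)
qed

lemma computable_rat_sum [computable_intros]:
  assumes "computable_rat (\<lambda>z. f (pfst z) (psnd z))" "computable h"
  shows "computable_rat (\<lambda>x. \<Sum>k < h x. f x k)"
proof -
  obtain P N D where f: "computable P" "computable N" "computable D"
    "\<And>x. D x > 0"
    "\<And>z. f (pfst z) (psnd z) = (of_nat (P z) - of_nat (N z)) / of_nat (D z)"
    using assms(1) by (rule computable_ratE) blast
  \<comment> \<open>The running sum is a coded triple of positive numerator, negative numerator and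
    denominator; one step adds the fraction for \<open>k\<close> without reducing.\<close>
  define next_sum where "next_sum x k r =
    pair (pfst r * D (pair x k) + P (pair x k) * psnd (psnd r))
      (pair (pfst (psnd r) * D (pair x k) + N (pair x k) * psnd (psnd r))
        (psnd (psnd r) * D (pair x k)))" for x k r
  define S where "S x n = rec_nat (pair 0 (pair 0 1)) (next_sum x) n" for x n
  have S: "psnd (psnd (S x n)) > 0 \<and>
      (\<Sum>k<n. f x k) = (of_nat (pfst (S x n)) - of_nat (pfst (psnd (S x n)))) / of_nat (psnd (psnd (S x n)))"
    for x n
  proof (induction n)
    case 0
    then show ?case by (simp add: S_def)
  next
    case (Suc n)
    then show ?case
      using f(4)[of "pair x n"] f(5)[of "pair x n"]
      by (simp add: S_def next_sum_def rat_add_frac)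
  qed
  have "computable (\<lambda>x. S x (h x))"
    unfolding S_def next_sum_def
    by (intro computable_intros assms f(1-3)[THEN computable_compose])
  then show ?thesis
    by (intro computable_ratI[of "\<lambda>x. pfst (S x (h x))" "\<lambda>x. pfst (psnd (S x (h x)))"
          "\<lambda>x. psnd (psnd (S x (h x)))"] computable_intros) (use S in auto)
qed

section \<open>Equality and canonical codes of rationals\<close>

lemma frac_eq_iff:
  "(of_nat p - of_nat n) / of_nat d = (of_nat p' - of_nat n') / (of_nat d' :: rat) \<longleftrightarrow>
     p * d' + n' * d = p' * d + n * d'" if "d > 0" "d' > 0" for p n d p' n' d' :: nat
proof -
  have "(of_nat p - of_nat n) / of_nat d = (of_nat p' - of_nat n') / (of_nat d' :: rat) \<longleftrightarrow>
     (of_nat p - of_nat n) * of_nat d' = (of_nat p' - of_nat n') * (of_nat d :: rat)"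
    using that by (simp add: frac_eq_eq)
  also have "\<dots> \<longleftrightarrow> (of_nat (p * d' + n' * d) :: rat) = of_nat (p' * d + n * d')"
    by (auto simp: algebra_simps)
  finally show ?thesis by (simp only: of_nat_eq_iff)
qed

lemma computable_pred_rat_eq [computable_intros]:
  assumes "computable_rat f" "computable_rat g"
  shows "computable_pred (\<lambda>x. f x = g x)"
proof -
  obtain P N D where f: "computable P" "computable N" "computable D"
    "\<And>x. D x > 0" "\<And>x. f x = (of_nat (P x) - of_nat (N x)) / of_nat (D x)"
    using assms(1) by (rule computable_ratE) blast
  obtain P' N' D' where g: "computable P'" "computable N'" "computable D'"
    "\<And>x. D' x > 0" "\<And>x. g x = (of_nat (P' x) - of_nat (N' x)) / of_nat (D' x)"
    using assms(2) by (rule computable_ratE) blast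
  show ?thesis
    unfolding f(5) g(5) frac_eq_iff[OF f(4) g(4)]
    by (intro computable_intros f(1-3) g(1-3))
qed

text \<open>Rests on the uniqueness of the reduced fraction with positive denominator. The value is
  to be found by search, so the code is described by conditions that can be tested on
  \<open>z\<close>; \<open>int_pos\<close> and \<open>int_neg\<close> add up to the absolute value
  of the numerator.\<close>

lemma rat_encode_unique:
  "z = rat_encode q \<longleftrightarrow> psnd z > 0 \<and> coprime (int_pos (pfst z) + int_neg (pfst z)) (psnd z) \<and>
     q = of_int (int_decode (pfst z)) / of_nat (psnd z)"
  (is "_ \<longleftrightarrow> ?R z")
proof -
  have cop: "coprime (int_pos e + int_neg e) d \<longleftrightarrow> coprime (int_decode e) (int d)" for e d
    using coprime_int_iff[of "int_pos e + int_neg e" d] by (simp only: flip: abs_int_decode) simp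
  obtain a b where ab: "quotient_of q = (a, b)" by fastforce
  note b = quotient_of_denom_pos[OF ab] and co = quotient_of_coprime[OF ab] and q = quotient_of_div[OF ab]
  have enc: "rat_encode q = pair (int_encode a) (nat b)" by (simp add: rat_encode_def ab)
  show ?thesis
  proof
    assume "z = rat_encode q"
    then have z: "z = pair (int_encode a) (nat b)" by (simp only: enc)
    show "?R z" unfolding cop z using b co q by simp
  next
    assume R: "?R z"
    let ?e = "int_decode (pfst z)" and ?d = "int (psnd z)"
    have "q = Fract ?e ?d" using R by (simp add: Fract_of_int_quotient)
    then have "quotient_of q = (?e, ?d)"
      using R cop[of "pfst z" "psnd z"] by (simp add: quotient_of_Fract normalize_stable)
    then have "a = ?e" "b = ?d" using ab by auto
    then show "z = rat_encode q" by (simp add: enc)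
  qed
qed

lemma computable_pred_coprime [computable_intros]:
  assumes "computable f" "computable g"
  shows "computable_pred (\<lambda>x. coprime (f x) (g x))"
proof -
  have *: "coprime a b \<longleftrightarrow> (\<forall>g < Suc (a + b). g dvd a \<longrightarrow> g dvd b \<longrightarrow> g = 1) \<and> a + b > 0" for a b :: nat
  proof
    assume co: "coprime a b"
    then have "a + b > 0" by (cases "a = 0") auto
    moreover have "g = 1" if "g dvd a" "g dvd b" for g
      using coprime_common_divisor_nat[OF co that] .
    ultimately show "(\<forall>g < Suc (a + b). g dvd a \<longrightarrow> g dvd b \<longrightarrow> g = 1) \<and> a + b > 0" by blast
  next
    assume R: "(\<forall>g < Suc (a + b). g dvd a \<longrightarrow> g dvd b \<longrightarrow> g = 1) \<and> a + b > 0"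
    have "gcd a b dvd a + b" by (rule dvd_add) simp_all
    then have "gcd a b < Suc (a + b)" using R by (meson dvd_imp_le le_imp_less_Suc)
    then have "gcd a b = 1" using R by simp
    then show "coprime a b" by (simp add: coprime_iff_gcd_eq_1)
  qed
  show ?thesis unfolding *
    by (intro computable_intros assms assms[THEN computable_compose])
qed

lemma computable_to_rat_if_computable_rat:
  assumes "computable_rat f"
  shows "computable_to_rat f"
proof -
  let ?Q = "\<lambda>x z. psnd z > 0 \<and> coprime (int_pos (pfst z) + int_neg (pfst z)) (psnd z) \<and>
     f x = of_int (int_decode (pfst z)) * (1 / of_nat (psnd z))"
  have *: "?Q x z \<longleftrightarrow> z = rat_encode (f x)" for x z
    unfolding rat_encode_unique by simp
  \<comment> \<open>The test has exactly one solution, so the search finds the canonical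
    code.\<close>
  have "computable (\<lambda>x. LEAST z. ?Q x z)"
  proof (rule computable_Least)
    show "\<exists>z. ?Q x z" for x unfolding * by blast
  qed (intro computable_intros computable_rat_compose[OF assms])
  then show ?thesis unfolding * computable_to_rat_def by (simp add: Least_equality)
qed

section \<open>The groups \<open>G i\<close> are uniformly computable\<close>

lemma computable_pred_prime [computable_intros]:
  assumes "computable f"
  shows "computable_pred (\<lambda>x. prime (f x))"
proof -
  have *: "prime p \<longleftrightarrow> 1 < p \<and> (\<forall>m < Suc p. m dvd p \<longrightarrow> m = 1 \<or> m = p)" for p :: nat
  proof -
    have "m < Suc p" if "m dvd p" "1 < p" for m
      using that by (simp add: dvd_imp_le less_Suc_eq_le)
    then show ?thesis unfolding prime_nat_iff by blast
  qed
  show ?thesis unfolding *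
    by (intro computable_intros assms assms[THEN computable_compose])
qed

lemma infinite_primes: "infinite {p :: nat. prime p}"
  using primes_infinite by simp

lemma computable_prime_seq [computable_intros]:
  assumes "computable f"
  shows "computable (\<lambda>x. prime_seq (f x))"
proof -
  have rec: "enumerate {p :: nat. prime p} n =
      rec_nat 2 (\<lambda>_ r. LEAST p. prime p \<and> r < p) n" for n
  proof (induction n)
    case 0
    have "(LEAST p :: nat. prime p) = 2"
      by (rule Least_equality) (auto dest: prime_ge_2_nat)
    then show ?case by (simp add: enumerate_0)
  next
    case (Suc n)
    then show ?case using enumerate_Suc''[OF infinite_primes, of n] by simp
  qed
  have "computable (\<lambda>r. LEAST p. prime p \<and> r < p)"
  proof (rule computable_Least)
    show "\<exists>p. prime p \<and> r < p" for r :: nat by (rule bigger_prime)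
  qed (intro computable_intros)
  note np = computable_compose[OF this]
  show ?thesis
    unfolding prime_seq_def rec by (intro computable_intros assms np)
qed

text \<open>A stage \<open>Suc (pair (pair x y) t)\<close> itself names the only pair that can
  enter, so the description by \<open>THE\<close> becomes a decidable test on the components of
  \<open>s - 1\<close>.\<close>

lemma gen_seq_eq:
  "gen_seq i s =
    (if s = 0 then 1
     else if (pfst (pfst (s - 1)), psnd (pfst (s - 1))) \<in> W_at i (psnd (s - 1)) \<and>
       (\<forall>t < psnd (s - 1). (pfst (pfst (s - 1)), psnd (pfst (s - 1))) \<notin> W_at i t)
     then 1 / of_nat (prime_seq (pfst (pfst (s - 1))) ^ psnd (pfst (s - 1)))
     else 0)"
proof (cases s)
  case (Suc n)
  have *: "enters_at i (x, y) s \<longleftrightarrow>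
      x = pfst (pfst n) \<and> y = psnd (pfst n) \<and> (x, y) \<in> W_at i (psnd n) \<and> (\<forall>t < psnd n. (x, y) \<notin> W_at i t)"
    for x y
    unfolding enters_at_def Suc by (auto simp: prod_encode_eq) (metis pair_pfst_psnd)+
  show ?thesis
  proof (cases "\<exists>xy. enters_at i xy s")
    case True
    then obtain x y where xy: "enters_at i (x, y) s" by fastforce
    then have "(THE xy. enters_at i xy s) = (x, y)"
      by (auto intro: enters_at_unique)
    then have "gen_seq i s = 1 / of_nat (prime_seq x) ^ y"
      using True Suc by (simp add: gen_seq_def)
    then show ?thesis using xy[unfolded *] Suc by auto
  next
    case False
    then have "gen_seq i s = 0" using Suc by (simp add: gen_seq_def)
    moreover have ne: "\<not> enters_at i (pfst (pfst n), psnd (pfst n)) s" using False by blast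
    ultimately show ?thesis using Suc ne[unfolded *] by auto
  qed
qed (simp add: gen_seq_def)

lemma computable_rat_gen_seq [computable_intros]:
  assumes "computable f" "computable g"
  shows "computable_rat (\<lambda>x. gen_seq (f x) (g x))"
  unfolding gen_seq_eq by (intro computable_intros assms assms[THEN computable_compose])

text \<open>Iterated tail on list codes, where a nonempty list is the successor of the pair of head
  and tail. The code 0 of the empty list is mapped to itself.\<close>

definition code_drop :: "nat \<Rightarrow> nat \<Rightarrow> nat" where
  "code_drop k a = rec_nat a (\<lambda>_ r. psnd (r - 1)) k"

lemma code_drop_list_encode: "code_drop k (list_encode xs) = list_encode (drop k xs)"
proof (induction k)
  case 0
  then show ?case by (simp add: code_drop_def)
next
  case (Suc k)
  have "psnd (list_encode ys - 1) = list_encode (tl ys)" for ys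
    using psnd_pair[of 0 0] by (cases ys) auto
  from this[of "drop k xs"] show ?case using Suc by (simp add: code_drop_def drop_Suc tl_drop)
qed

lemma length_le_list_encode: "length xs \<le> list_encode xs"
proof (induction xs)
  case (Cons x xs)
  then show ?case using le_prod_encode_2[of "list_encode xs" x] by simp
qed simp

text \<open>A list is no longer than its code, so summing up to \<open>a\<close> reaches every
  entry; positions beyond the end, recognised by an empty remaining list, contribute 0.\<close>

lemma G_interp_eq:
  "G_interp i a = (\<Sum>k<a. if code_drop k a = 0 then 0
     else of_int (int_decode (pfst (code_drop k a - 1))) * gen_seq i k)"
proof -
  obtain xs where a: "a = list_encode xs" by (metis list_decode_inverse)
  have "G_interp i a = (\<Sum>k<length xs. of_int (int_decode (xs ! k)) * gen_seq i k)"
    by (simp add: G_interp_def seq_decode_def a)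
  also have "\<dots> = (\<Sum>k<length xs. if code_drop k a = 0 then 0
     else of_int (int_decode (pfst (code_drop k a - 1))) * gen_seq i k)"
    by (rule sum.cong) (auto simp: a code_drop_list_encode simp flip: Cons_nth_drop_Suc)
  also have "\<dots> = (\<Sum>k<a. if code_drop k a = 0 then 0
     else of_int (int_decode (pfst (code_drop k a - 1))) * gen_seq i k)"
    using length_le_list_encode[of xs]
    by (intro sum.mono_neutral_left) (auto simp: a code_drop_list_encode)
  finally show ?thesis .
qed

lemma computable_rat_G_interp [computable_intros]:
  assumes "computable f" "computable g"
  shows "computable_rat (\<lambda>x. G_interp (f x) (g x))"
  unfolding G_interp_eq code_drop_def
  by (intro computable_intros assms assms[THEN computable_compose])

section \<open>Embeddability is multiplication by a nonzero rational\<close>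

definition additive_subgroup :: "rat set \<Rightarrow> bool" where
  "additive_subgroup S \<longleftrightarrow> 0 \<in> S \<and> (\<forall>a\<in>S. \<forall>b\<in>S. a + b \<in> S) \<and> (\<forall>a\<in>S. - a \<in> S)"

lemma additive_subgroup_of_nat_mult:
  assumes "additive_subgroup S" "a \<in> S"
  shows "of_nat n * a \<in> S"
  by (induction n) (use assms in \<open>auto simp: additive_subgroup_def distrib_right\<close>)

lemma additive_subgroup_of_int_mult:
  assumes "additive_subgroup S" "a \<in> S"
  shows "of_int k * a \<in> S"
proof (cases k)
  case (nonneg n)
  then show ?thesis using additive_subgroup_of_nat_mult[OF assms, of n] by simp
next
  case (neg n)
  then have "(of_int k :: rat) = - of_nat (Suc n)" by simp
  then have "of_int k * a = - (of_nat (Suc n) * a)" by (simp only: mult_minus_left)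
  then show ?thesis
    using additive_subgroup_of_nat_mult[OF assms, of "Suc n"] assms(1)
    unfolding additive_subgroup_def by metis
qed

lemma range_G_interp:
  "range (G_interp i) = {\<Sum>k<n. of_int (z k) * gen_seq i k | n z. True}"
proof (intro equalityI subsetI)
  fix q assume "q \<in> {\<Sum>k<n. of_int (z k) * gen_seq i k | n z. True}"
  then obtain n z where q: "q = (\<Sum>k<n. of_int (z k) * gen_seq i k)" by blast
  have "G_interp i (list_encode (map int_encode (map z [0..<n]))) = q"
    by (simp add: G_interp_def seq_decode_def q)
  then show "q \<in> range (G_interp i)" by blast
qed (auto simp: G_interp_def)

lemma sum_in_range_G_interp: "(\<Sum>k<n. of_int (z k) * gen_seq i k) \<in> range (G_interp i)"
  unfolding range_G_interp by blast

lemma gen_seq_in_range: "gen_seq i s \<in> range (G_interp i)"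
proof -
  have "gen_seq i s = (\<Sum>k<Suc s. of_int (of_bool (k = s)) * gen_seq i k)"
    by simp
  then show ?thesis by (simp only: sum_in_range_G_interp)
qed

lemma additive_subgroup_range_G_interp: "additive_subgroup (range (G_interp i))"
  unfolding additive_subgroup_def
proof (intro conjI ballI)
  show "0 \<in> range (G_interp i)"
    unfolding range_G_interp by (auto intro!: exI[of _ "0 :: nat"])
next
  fix a b assume "a \<in> range (G_interp i)" "b \<in> range (G_interp i)"
  then obtain n z m w where
    a: "a = (\<Sum>k<n. of_int (z k) * gen_seq i k)" and b: "b = (\<Sum>k<m. of_int (w k) * gen_seq i k)"
    unfolding range_G_interp by blast
  \<comment> \<open>Both combinations are padded with zero coefficients to the common length
    \<open>n + m\<close>.\<close>
  have pad: "(\<Sum>k<l. of_int (v k) * gen_seq i k) =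
      (\<Sum>k<n + m. of_int (if k < l then v k else 0) * gen_seq i k)" if "l \<le> n + m" for l v
    by (rule sum.mono_neutral_cong_left) (use that in auto)
  have "a + b = (\<Sum>k<n + m. of_int ((if k < n then z k else 0) + (if k < m then w k else 0)) * gen_seq i k)"
    unfolding a b pad[of n, simplified] pad[of m, simplified] sum.distrib[symmetric]
    by (rule sum.cong) (auto simp: distrib_right)
  then show "a + b \<in> range (G_interp i)" by (simp only: sum_in_range_G_interp)
next
  fix a assume "a \<in> range (G_interp i)"
  then obtain n z where "a = (\<Sum>k<n. of_int (z k) * gen_seq i k)" unfolding range_G_interp by blast
  then have "- a = (\<Sum>k<n. of_int (- z k) * gen_seq i k)" by (simp add: sum_negf)
  then show "- a \<in> range (G_interp i)" by (simp only: sum_in_range_G_interp)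
qed

lemma one_in_range_G_interp: "1 \<in> range (G_interp i)"
  using gen_seq_in_range[of i 0] by (simp add: gen_seq_def)

lemma gen_seq_enters_at:
  assumes "enters_at i (x, y) s"
  shows "gen_seq i s = 1 / of_nat (prime_seq x) ^ y"
proof -
  have "(THE xy. enters_at i xy s) = (x, y)" using assms by (auto intro: enters_at_unique)
  moreover have "s \<noteq> 0" using assms by (auto simp: enters_at_def)
  ultimately show ?thesis using assms by (auto simp: gen_seq_def)
qed

lemma W_in_range_G_interp:
  assumes "(x, y) \<in> W i"
  shows "1 / of_nat (prime_seq x) ^ y \<in> range (G_interp i)"
  using assms gen_seq_in_range[of i] unfolding enters_at_exists by (metis gen_seq_enters_at)

text \<open>Serves as induction principle for the elements of the group: a property that defines a
  subgroup needs checking only at the generators.\<close>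

lemma range_G_interp_least:
  assumes S: "additive_subgroup S" "1 \<in> S"
    and W: "\<And>x y. (x, y) \<in> W i \<Longrightarrow> 1 / of_nat (prime_seq x) ^ y \<in> S"
  shows "range (G_interp i) \<subseteq> S"
proof
  have gen: "gen_seq i s \<in> S" for s
  proof (cases "s \<noteq> 0 \<and> (\<exists>xy. enters_at i xy s)")
    case True
    then obtain x y where "enters_at i (x, y) s" by fastforce
    then show ?thesis using W enters_at_exists[of "(x, y)" i] by (auto simp: gen_seq_enters_at)
  next
    case False
    then show ?thesis using S by (auto simp: gen_seq_def additive_subgroup_def)
  qed
  fix q assume "q \<in> range (G_interp i)"
  then obtain n z where q: "q = (\<Sum>k<n. of_int (z k) * gen_seq i k)" unfolding range_G_interp by blast
  show "q \<in> S" unfolding q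
    by (induction n) (use S(1) additive_subgroup_of_int_mult[OF S(1) gen] in \<open>auto simp: additive_subgroup_def\<close>)
qed

section \<open>Computability of the group operations\<close>

lemma G_interp_G_code: "q \<in> range (G_interp i) \<Longrightarrow> G_interp i (G_code i q) = q"
  unfolding G_code_def by (rule LeastI_ex) auto

lemma G_sel [simp]: "interp (G i) = G_interp i" "ident (G i) a = (if G_interp i a = 0 then 1 else 0)"
  "oplus (G i) a b = G_code i (G_interp i a + G_interp i b)" "ominus (G i) a = G_code i (- G_interp i a)"
  by (simp_all add: G_def)

text \<open>Closure of the range under sums and negatives makes every search for a code succeed; the
  axioms then follow from those of the rationals.\<close>

lemma computable_subgroup_G: "computable_subgroup (G i)"
proof -
  have add: "G_interp i a + G_interp i b \<in> range (G_interp i)" for a b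
    using additive_subgroup_range_G_interp[of i] by (auto simp: additive_subgroup_def)
  have neg: "- G_interp i a \<in> range (G_interp i)" for a
    using additive_subgroup_range_G_interp[of i] by (auto simp: additive_subgroup_def)
  have interp_add: "G_interp i (G_code i (G_interp i a + G_interp i b)) = G_interp i a + G_interp i b" for a b
    by (rule G_interp_G_code[OF add])
  have interp_neg: "G_interp i (G_code i (- G_interp i a)) = - G_interp i a" for a
    by (rule G_interp_G_code[OF neg])
  have interp_0: "G_interp i (G_code i 0) = 0"
    using additive_subgroup_range_G_interp[of i] by (intro G_interp_G_code) (simp add: additive_subgroup_def)
  have "computable (ident (G i))"
    unfolding G_def presentation.simps by (intro computable_intros)
  moreover have "computable2 (oplus (G i))"
  proof -
    have "computable (\<lambda>n. LEAST c. G_interp i c = G_interp i (pfst n) + G_interp i (psnd n))"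
    proof (rule computable_Least)
      show "\<exists>c. G_interp i c = G_interp i (pfst n) + G_interp i (psnd n)" for n
        using interp_add by blast
    qed (intro computable_intros)
    then show ?thesis
      by (simp add: computable2_def G_code_def pfst_def psnd_def case_prod_unfold)
  qed
  moreover have "computable (ominus (G i))"
  proof -
    have "computable (\<lambda>a. LEAST c. G_interp i c = - G_interp i a)"
    proof (rule computable_Least)
      show "\<exists>c. G_interp i c = - G_interp i a" for a using interp_neg by blast
    qed (intro computable_intros)
    then show ?thesis by (simp add: G_def G_code_def)
  qed
  moreover have "computable_to_rat (interp (G i))"
    unfolding G_sel
    by (rule computable_to_rat_if_computable_rat) (intro computable_intros)
  ultimately show ?thesis
    unfolding computable_subgroup_def by (simp add: interp_add interp_neg interp_0 add.assoc)
qed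

text \<open>Every number denotes some rational here, reduced or not, and every rational is denoted.
  Quantifiers over multipliers thus become quantifiers over numbers.\<close>

definition rat_of_code :: "nat \<Rightarrow> rat" where
  "rat_of_code n = of_int (int_decode (pfst n)) * (1 / of_nat (psnd n))"

lemma rat_of_code_surj: "\<exists>n. rat_of_code n = q"
proof -
  have "q = rat_of_code (rat_encode q)"
    using rat_encode_unique[of "rat_encode q" q] by (simp add: rat_of_code_def)
  then show ?thesis by metis
qed

lemma computable_rat_rat_of_code [computable_intros]:
  "computable f \<Longrightarrow> computable_rat (\<lambda>x. rat_of_code (f x))"
  unfolding rat_of_code_def by (intro computable_intros)

text \<open>For \<open>q = a / b\<close> with integers \<open>a\<close> and \<open>b\<close>,
  additivity gives \<open>b * h q = h a = a * h 1\<close>.\<close>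

lemma additive_map_eq_mult:
  fixes h :: "rat \<Rightarrow> rat"
  assumes S: "additive_subgroup S" "1 \<in> S"
    and add: "\<And>q r. q \<in> S \<Longrightarrow> r \<in> S \<Longrightarrow> h (q + r) = h q + h r"
    and "q \<in> S"
  shows "h q = h 1 * q"
proof -
  have zero: "h 0 = 0" using add[of 0 0] S by (simp add: additive_subgroup_def)
  have nat: "h (of_nat n * r) = of_nat n * h r" if "r \<in> S" for n r
    by (induction n)
       (use that zero add additive_subgroup_of_nat_mult[OF S(1)] in \<open>auto simp: distrib_right\<close>)
  have neg: "h (- r) = - h r" if "r \<in> S" for r
    using add[of r "- r"] that S zero by (auto simp: additive_subgroup_def)
  have int: "h (of_int k * r) = of_int k * h r" if "r \<in> S" for k r
  proof (cases k)
    case (nonneg n)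
    then show ?thesis using nat[OF that, of n] by simp
  next
    case (neg n)
    then have "of_int k = - (of_nat (Suc n) :: rat)" by simp
    then show ?thesis
      using nat[OF that, of "Suc n"] \<open>\<And>r. r \<in> S \<Longrightarrow> h (- r) = - h r\<close>[OF additive_subgroup_of_nat_mult[OF S(1) that, of "Suc n"]]
      by (simp only: mult_minus_left)
  qed
  obtain a b where "quotient_of q = (a, b)" by fastforce
  then have b: "b > 0" and q: "q = of_int a / of_int b"
    using quotient_of_denom_pos quotient_of_div by blast+
  have "of_int b * h q = h (of_int b * q)" using int[OF \<open>q \<in> S\<close>] by simp
  also have "of_int b * q = of_int a * 1" using b q by simp
  also have "h \<dots> = of_int a * h 1" by (rule int[OF S(2)])
  finally show ?thesis using b by (simp add: q field_simps)
qed

lemma computably_embeddable_G_iff: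
  "computably_embeddable (G i) (G j) \<longleftrightarrow> (\<exists>r. r \<noteq> 0 \<and> (\<forall>a. \<exists>b. r * G_interp i a = G_interp j b))"
proof
  assume "computably_embeddable (G i) (G j)"
  then obtain \<phi> h where h: "\<And>a. h (G_interp i a) = G_interp j (\<phi> a)"
    "inj_on h (range (G_interp i))"
    "\<And>q r. q \<in> range (G_interp i) \<Longrightarrow> r \<in> range (G_interp i) \<Longrightarrow> h (q + r) = h q + h r"
    unfolding computably_embeddable_def computable_embedding_def G_sel by blast
  note S = additive_subgroup_range_G_interp[of i] one_in_range_G_interp[of i]
  have eq: "h q = h 1 * q" if "q \<in> range (G_interp i)" for q
    using additive_map_eq_mult[OF S, of h] h(3) that by blast
  have 0: "0 \<in> range (G_interp i)" using S by (simp add: additive_subgroup_def)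
  \<comment> \<open>Otherwise 1 and 0 would have the same image, against injectivity.\<close>
  have "h 1 \<noteq> 0"
    using eq[OF 0] inj_onD[OF h(2) _ S(2) 0] by auto
  moreover have "h 1 * G_interp i a = G_interp j (\<phi> a)" for a
    using eq[of "G_interp i a"] h(1)[of a] by simp
  ultimately show "\<exists>r. r \<noteq> 0 \<and> (\<forall>a. \<exists>b. r * G_interp i a = G_interp j b)" by blast
next
  assume "\<exists>r. r \<noteq> 0 \<and> (\<forall>a. \<exists>b. r * G_interp i a = G_interp j b)"
  then obtain r where r: "r \<noteq> 0" "\<And>a. \<exists>b. G_interp j b = r * G_interp i a" by metis
  obtain n where n: "rat_of_code n = r" using rat_of_code_surj by blast
  \<comment> \<open>The map is computed by searching the target for a code of the image; the choice
    of \<open>r\<close> guarantees that the search ends.\<close>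
  define \<phi> where "\<phi> a = (LEAST b. G_interp j b = r * G_interp i a)" for a
  have "computable \<phi>"
    unfolding \<phi>_def
  proof (rule computable_Least)
    show "computable_pred (\<lambda>z. G_interp j (psnd z) = r * G_interp i (pfst z))"
      unfolding n[symmetric] by (intro computable_intros)
  qed (rule r(2))
  moreover have "G_interp j (\<phi> a) = r * G_interp i a" for a
    unfolding \<phi>_def by (rule LeastI_ex[OF r(2)])
  ultimately have "computable_embedding (G i) (G j) \<phi>"
    unfolding computable_embedding_def G_sel
    using r(1) computable_subgroup_G
    by (auto intro!: exI[of _ "\<lambda>q. r * q"] inj_onI simp: distrib_left)
  then show "computably_embeddable (G i) (G j)" unfolding computably_embeddable_def by blast
qed

section \<open>The upper bound on the complexity of embeddability\<close>

lemma Sigma03_preorder_embeddable: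
  "Sigma03_preorder {(i, j). computably_embeddable (G i) (G j)}"
proof -
  \<comment> \<open>\<open>a\<close> codes the multiplier, \<open>b\<close> an element of the source
    and \<open>c\<close> its image.\<close>
  let ?Q = "\<lambda>x y a b c. rat_of_code a \<noteq> 0 \<and> rat_of_code a * G_interp x b = G_interp y c"
  let ?D = "{n. ?Q (pfst n) (pfst (psnd n)) (pfst (psnd (psnd n)))
    (pfst (psnd (psnd (psnd n)))) (psnd (psnd (psnd (psnd n))))}"
  have "Sigma03 {(i, j). computably_embeddable (G i) (G j)}"
    unfolding Sigma03_def
  proof (intro exI conjI allI)
    show "decidable ?D"
      unfolding computable_pred_decidable[symmetric] by (intro computable_intros)
    fix x y
    have "computably_embeddable (G x) (G y) \<longleftrightarrow> (\<exists>a. \<forall>b. \<exists>c. ?Q x y a b c)"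
      unfolding computably_embeddable_G_iff by (metis rat_of_code_surj)
    then show "(x, y) \<in> {(i, j). computably_embeddable (G i) (G j)} \<longleftrightarrow>
        (\<exists>a. \<forall>b. \<exists>c. pair x (pair y (pair a (pair b c))) \<in> ?D)"
      by simp
  qed
  moreover have "preorder_on UNIV {(i, j). computably_embeddable (G i) (G j)}"
    unfolding preorder_on_def
  proof (intro conjI)
    show "refl {(i, j). computably_embeddable (G i) (G j)}"
      by (auto simp: refl_on_def computably_embeddable_G_iff intro!: exI[of _ "1 :: rat"])
    show "trans {(i, j). computably_embeddable (G i) (G j)}"
    proof (rule transI; clarsimp simp: computably_embeddable_G_iff)
      fix i j k :: nat and r s :: rat
      assume r: "r \<noteq> 0" "\<forall>a. \<exists>b. r * G_interp i a = G_interp j b"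
        and s: "s \<noteq> 0" "\<forall>a. \<exists>b. s * G_interp j a = G_interp k b"
      have "\<exists>b. (s * r) * G_interp i a = G_interp k b" for a
        using r(2) s(2) by (metis mult.assoc)
      with r(1) s(1) show "\<exists>r. r \<noteq> 0 \<and> (\<forall>a. \<exists>b. r * G_interp i a = G_interp k b)"
        by (intro exI[of _ "s * r"]) auto
    qed
  qed simp_all
  ultimately show ?thesis unfolding Sigma03_preorder_def by blast
qed

section \<open>Parametrised recursively enumerable sets\<close>

text \<open>Both computations lead to halted states of the same machine run. Halted states are fixed
  points, so the two coincide after \<open>k + l\<close> steps.\<close>

lemma eval_deterministic:
  assumes "eval p x y u" "eval p x z v"
  shows "y = z"
proof -
  obtain k where k: "(step ^^ k) (run p x 0 0) = quad 0 y 0 u"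
    using machine_complete[OF assms(1), of 0 0] by auto
  obtain l where l: "(step ^^ l) (run p x 0 0) = quad 0 z 0 v"
    using machine_complete[OF assms(2), of 0 0] by auto
  have "(step ^^ (k + l)) (run p x 0 0) = quad 0 y 0 u"
    by (rule funpow_step_trans[OF k]) (simp add: funpow_fixpoint)
  moreover have "(step ^^ (l + k)) (run p x 0 0) = quad 0 z 0 v"
    by (rule funpow_step_trans[OF l]) (simp add: funpow_fixpoint)
  ultimately show ?thesis by (simp add: add.commute)
qed

lemma eval_Search_imp:
  "eval (Search p) (pair a m) n t \<Longrightarrow> \<exists>s. eval p (pair a n) 0 s"
  by (induction "Search p" "pair a m" n t arbitrary: m rule: eval.induct) auto

lemma eval_Comp_iff:
  assumes "eval g x y s"
  shows "(\<exists>z t. eval (Comp f g) x z t) \<longleftrightarrow> (\<exists>z t. eval f y z t)"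
proof
  assume "\<exists>z t. eval (Comp f g) x z t"
  then obtain z t where "eval (Comp f g) x z t" by blast
  then show "\<exists>z t. eval f y z t"
    by cases (use eval_deterministic[OF assms] in blast)
qed (use assms eval.Comp in blast)

text \<open>An instance of the s-m-n theorem: \<open>u\<close> is built into the program as
  \<open>Const u\<close>, and the program then searches for \<open>s\<close>.\<close>

lemma re_set_param:
  assumes "computable_pred R"
  shows "\<exists>f. computable f \<and> (\<forall>u. re_set (f u) = {v. \<exists>s. R (pair (pair u v) s)})"
proof -
  have "computable (\<lambda>z. of_bool (\<not> R z))" by (intro computable_intros assms)
  then obtain p where p: "\<forall>z. \<exists>t. eval p z (of_bool (\<not> R z)) t" by (rule computableE)
  define q where "q = Comp (Search p) (Pairing Ident Zero)"
  define f where "f u = prog_encode (Comp q (Pairing (Const u) Ident))" for u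
  \<comment> \<open>Each successor composes one more \<open>Succ\<close>, whose code is 1, so the
    codes of the constant programs are primitive recursive in \<open>u\<close>.\<close>
  have Const: "prog_encode (Const u) = rec_nat 0 (\<lambda>_ r. 5 + 4 * pair 1 r) u" for u
    by (induction u) auto
  have "computable f"
    unfolding f_def prog_encode.simps Const by (intro computable_intros)
  moreover have "re_set (f u) = {v. \<exists>s. R (pair (pair u v) s)}" for u
  proof -
    have "v \<in> re_set (f u) \<longleftrightarrow> (\<exists>s. R (pair (pair u v) s))" for v
    proof -
      obtain t where "eval (Const u) v u t" using eval_Const by blast
      then have 1: "eval (Pairing (Const u) Ident) v (pair u v) (Suc (t + 3))"
        by (intro eval.Pairing eval_Ident)
      have 2: "eval (Pairing Ident Zero) (pair u v) (pair (pair u v) 0) (Suc (3 + 1))"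
        by (intro eval.Pairing eval_Ident eval.Zero)
      have "v \<in> re_set (f u) \<longleftrightarrow> (\<exists>z t. eval (Comp q (Pairing (Const u) Ident)) v z t)"
        unfolding re_set_def f_def prog_encode_inject by auto
      also have "\<dots> \<longleftrightarrow> (\<exists>z t. eval (Search p) (pair (pair u v) 0) z t)"
        unfolding eval_Comp_iff[OF 1] q_def eval_Comp_iff[OF 2] ..
      also have "\<dots> \<longleftrightarrow> (\<exists>s. R (pair (pair u v) s))"
      proof
        assume "\<exists>z t. eval (Search p) (pair (pair u v) 0) z t"
        then obtain z s where "eval p (pair (pair u v) z) 0 s" using eval_Search_imp by blast
        then have "of_bool (\<not> R (pair (pair u v) z)) = (0 :: nat)"
          using p eval_deterministic by blast
        then show "\<exists>s. R (pair (pair u v) s)" by auto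
      next
        assume "\<exists>s. R (pair (pair u v) s)"
        then obtain s where "of_bool (\<not> R (pair (pair u v) s)) = (0 :: nat)" by auto
        from eval_Search_0[OF p[rule_format] this]
        show "\<exists>z t. eval (Search p) (pair (pair u v) 0) z t" by blast
      qed
      finally show ?thesis .
    qed
    then show ?thesis by blast
  qed
  ultimately show ?thesis by blast
qed

section \<open>Embeddability in terms of the sets \<open>W i\<close>\<close>

lemma prime_prime_seq: "c > 0 \<Longrightarrow> prime (prime_seq c)"
  using enumerate_in_set[OF infinite_primes] by (simp add: prime_seq_def)

lemma inj_prime_seq: "inj prime_seq"
proof (rule injI)
  fix x y assume eq: "prime_seq x = prime_seq y"
  have ne1: "prime_seq c \<noteq> 1" if "c > 0" for c
    using prime_prime_seq[OF that] by auto
  have 0: "prime_seq 0 = 1" by (simp add: prime_seq_def)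
  show "x = y"
  proof (cases "x = 0 \<or> y = 0")
    case True
    then show ?thesis using eq ne1 0 by (metis neq0_conv)
  next
    case False
    then have "x - 1 = y - 1"
      using eq strict_mono_eq[OF strict_mono_enumerate[OF infinite_primes], of "x - 1" "y - 1"]
      by (simp add: prime_seq_def)
    then show ?thesis using False by linarith
  qed
qed

lemma prime_seq_pos: "prime_seq c > 0"
  using prime_prime_seq[of c] by (cases "c = 0") (auto simp: prime_seq_def prime_gt_0_nat)

lemma W_downward: "(c, k) \<in> W i \<Longrightarrow> l \<le> k \<Longrightarrow> (c, l) \<in> W i"
  by (auto simp: W_def intro: le_trans)

text \<open>The multiplier is the product of the primes attached to \<open>B\<close>. It cancels one
  power of each of them in denominators, which makes up for the missing unit of height.\<close>

lemma embeddableI: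
  assumes "finite B"
    and W: "\<And>c k. (c, k) \<in> W i \<Longrightarrow> (c, k) \<in> W j \<or> c \<in> B \<and> (c, k - 1) \<in> W j"
  shows "computably_embeddable (G i) (G j)"
proof -
  define r where "r = (\<Prod>c\<in>B. prime_seq c)"
  have "r > 0" unfolding r_def by (intro prod_pos) (simp add: prime_seq_pos)
  \<comment> \<open>The preimage of the target group under multiplication by \<open>r\<close>; it
    suffices that it contains the generators of the source.\<close>
  define S where "S = {q. of_nat r * q \<in> range (G_interp j)}"
  note j = additive_subgroup_range_G_interp[of j]
  have mult: "of_nat n * q \<in> range (G_interp j)" if "q \<in> range (G_interp j)" for n q
    using additive_subgroup_of_nat_mult[OF j that] .
  have "additive_subgroup S"
    using j by (auto simp: additive_subgroup_def S_def distrib_left)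
  moreover have "1 \<in> S"
    unfolding S_def using mult[OF one_in_range_G_interp] by blast
  moreover have "1 / of_nat (prime_seq c) ^ k \<in> S" if ck: "(c, k) \<in> W i" for c k
  proof (cases "(c, k) \<in> W j")
    case True
    then show ?thesis unfolding S_def using mult[OF W_in_range_G_interp] by blast
  next
    case False
    then have c: "c \<in> B" "(c, k - 1) \<in> W j" using W[OF ck] by auto
    then obtain l where k: "k = Suc l" using False by (cases k) auto
    have "r = prime_seq c * (\<Prod>c\<in>B - {c}. prime_seq c)"
      unfolding r_def by (rule prod.remove[OF assms(1) c(1)])
    then have "of_nat r * (1 / of_nat (prime_seq c) ^ k) =
        (of_nat (\<Prod>c\<in>B - {c}. prime_seq c) * (1 / of_nat (prime_seq c) ^ l) :: rat)"
      using prime_seq_pos[of c] k by simp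
    moreover have "(c, l) \<in> W j" using c(2) k by simp
    ultimately show ?thesis
      unfolding S_def using mult[OF W_in_range_G_interp] by (simp only: mem_Collect_eq)
  qed
  ultimately have "range (G_interp i) \<subseteq> S" by (rule range_G_interp_least)
  then have "\<forall>a. \<exists>b. of_nat r * G_interp i a = G_interp j b"
    unfolding S_def by blast
  moreover have "(of_nat r :: rat) \<noteq> 0" using \<open>r > 0\<close> by simp
  ultimately show ?thesis unfolding computably_embeddable_G_iff by blast
qed

text \<open>A bound on the valuation at the prime of column \<open>c\<close>: denominators contain
  it to the power \<open>k\<close> at most, and \<open>d\<close> clears the other primes. This
  condition defines a subgroup, so it is checked on the generators.\<close>

lemma range_G_interp_denominator:
  assumes "c > 0" "(c, Suc k) \<notin> W j" "q \<in> range (G_interp j)"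
  shows "\<exists>d. \<not> prime_seq c dvd d \<and> of_nat d * of_nat (prime_seq c) ^ k * q \<in> \<int>"
proof -
  let ?p = "prime_seq c"
  have p: "prime ?p" using assms(1) by (rule prime_prime_seq)
  define S where "S = {q :: rat. \<exists>d. \<not> ?p dvd d \<and> of_nat d * of_nat ?p ^ k * q \<in> \<int>}"
  have "additive_subgroup S"
    unfolding additive_subgroup_def
  proof (intro conjI ballI)
    show "0 \<in> S" using p by (auto simp: S_def intro!: exI[of _ 1])
    fix a assume "a \<in> S"
    then show "- a \<in> S" by (auto simp: S_def)
    fix b assume "b \<in> S"
    with \<open>a \<in> S\<close> obtain d e where d: "\<not> ?p dvd d" "of_nat d * of_nat ?p ^ k * a \<in> \<int>"
      and e: "\<not> ?p dvd e" "of_nat e * of_nat ?p ^ k * b \<in> \<int>" unfolding S_def by blast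
    have "of_nat (d * e) * of_nat ?p ^ k * (a + b) =
        of_nat e * (of_nat d * of_nat ?p ^ k * a) + of_nat d * (of_nat e * of_nat ?p ^ k * b)"
      by (simp add: algebra_simps)
    also have "\<dots> \<in> \<int>" by (intro Ints_add Ints_mult[OF _ d(2)] Ints_mult[OF _ e(2)]) simp_all
    finally have "of_nat (d * e) * of_nat ?p ^ k * (a + b) \<in> \<int>" .
    moreover have "\<not> ?p dvd d * e" using p d e by (simp add: prime_dvd_mult_iff)
    ultimately show "a + b \<in> S" unfolding S_def by blast
  qed
  moreover have "1 \<in> S" using p by (auto simp: S_def intro!: exI[of _ 1])
  moreover have "1 / of_nat (prime_seq c') ^ y \<in> S" if cy: "(c', y) \<in> W j" for c' y
  proof (cases "c' = c")
    case True
    then have "y \<le> k" using W_downward[of c y j "Suc k"] cy assms(2) by fastforce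
    then obtain l where "k = y + l" by (auto simp: le_iff_add)
    then have "of_nat ?p ^ k * (1 / of_nat ?p ^ y) = (of_nat (?p ^ l) :: rat)"
      using prime_seq_pos[of c] by (simp add: power_add)
    then have "of_nat 1 * of_nat ?p ^ k * (1 / of_nat ?p ^ y) \<in> (\<int> :: rat set)" by simp
    then show ?thesis unfolding S_def True using p by (auto intro!: exI[of _ 1])
  next
    case False
    have "\<not> ?p dvd prime_seq c'"
    proof (cases "c' = 0")
      case True
      then have "prime_seq c' = 1" by (simp add: prime_seq_def)
      then show ?thesis using p by auto
    next
      case False
      then show ?thesis using primes_dvd_imp_eq[OF p prime_prime_seq[of c']]
        injD[OF inj_prime_seq, of c c'] \<open>c' \<noteq> c\<close> by auto
    qed
    then have "\<not> ?p dvd prime_seq c' ^ y" using p prime_dvd_power by blast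
    moreover have "of_nat (prime_seq c' ^ y) * of_nat ?p ^ k * (1 / of_nat (prime_seq c') ^ y) \<in> (\<int> :: rat set)"
      using prime_seq_pos[of c'] by simp
    ultimately show ?thesis unfolding S_def by blast
  qed
  ultimately have "range (G_interp j) \<subseteq> S" by (rule range_G_interp_least)
  then show ?thesis using assms(3) unfolding S_def by blast
qed

text \<open>Let the multiplier be \<open>a / b\<close>. Where column \<open>c\<close> is higher in
  \<open>W i\<close>, the multiplier has to cancel a factor \<open>prime_seq c\<close>, so this
  prime divides \<open>a\<close>, and a nonzero integer has finitely many divisors.\<close>

lemma finite_if_embeddable:
  assumes "computably_embeddable (G i) (G j)"
  shows "finite {c. \<exists>k. (c, Suc k) \<in> W i \<and> (c, Suc k) \<notin> W j}"
proof -
  obtain r where r: "r \<noteq> 0" "\<And>a. \<exists>b. r * G_interp i a = G_interp j b"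
    using assms unfolding computably_embeddable_G_iff by blast
  obtain a b where "quotient_of r = (a, b)" by fastforce
  then have b: "b > 0" and ab: "r = of_int a / of_int b"
    using quotient_of_denom_pos quotient_of_div by blast+
  have a: "a \<noteq> 0" using r ab by auto
  have "prime_seq c dvd nat \<bar>a\<bar>" if c: "c > 0" and k: "(c, Suc k) \<in> W i" "(c, Suc k) \<notin> W j" for c k
  proof -
    let ?p = "prime_seq c"
    have p: "prime ?p" using c by (rule prime_prime_seq)
    have "r * (1 / of_nat ?p ^ Suc k) \<in> range (G_interp j)"
      using W_in_range_G_interp[OF k(1)] r(2) by fastforce
    from range_G_interp_denominator[OF c k(2) this] obtain d m where
      d: "\<not> ?p dvd d" and m: "of_nat d * of_nat ?p ^ k * (r * (1 / of_nat ?p ^ Suc k)) = (of_int m :: rat)"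
      by (auto elim: Ints_cases)
    have "(of_int (int d * a) :: rat) = of_int (m * b * int ?p)"
      using m b prime_seq_pos[of c] by (simp add: ab field_simps)
    then have "int d * a = m * b * int ?p" by (simp only: of_int_eq_iff)
    then have "int ?p dvd int d * a" by simp
    then have "int ?p dvd a" using p d by (auto simp: prime_dvd_mult_iff)
    then show ?thesis by (simp add: nat_abs_dvd_iff nat_dvd_iff flip: int_dvd_int_iff)
  qed
  \<comment> \<open>Column 0 carries \<open>prime_seq 0 = 1\<close>, which is no prime, so it is set
    aside; it adds at most one element.\<close>
  then have "prime_seq ` ({c. \<exists>k. (c, Suc k) \<in> W i \<and> (c, Suc k) \<notin> W j} - {0}) \<subseteq> {d. d dvd nat \<bar>a\<bar>}"
    by auto
  moreover have "finite {d. d dvd nat \<bar>a\<bar>}" using a by (intro finite_divisors_nat) simp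
  ultimately have "finite (prime_seq ` ({c. \<exists>k. (c, Suc k) \<in> W i \<and> (c, Suc k) \<notin> W j} - {0}))"
    by (rule finite_subset)
  then have "finite ({c. \<exists>k. (c, Suc k) \<in> W i \<and> (c, Suc k) \<notin> W j} - {0})"
    by (rule finite_imageD) (rule inj_on_subset[OF inj_prime_seq], simp)
  then show ?thesis by simp
qed

section \<open>Coding a preorder\<close>

text \<open>
  A column \<open>c\<close> stands for the guess that the finite set \<open>set_decode c\<close> is upward closed under the
  preorder. An edge \<open>e = pair x (pair y a)\<close> refutes it up to level \<open>j\<close> if it leaves the set and
  the witness \<open>a\<close> for \<open>x \<le> y\<close> looks correct for all \<open>b < j\<close>. Only finitely many edges may refute
  a given column, and every edge may refute almost every column.
\<close>

definition edge_refutes :: "nat set \<Rightarrow> nat \<Rightarrow> nat \<Rightarrow> nat \<Rightarrow> bool" where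
  "edge_refutes D e b z \<longleftrightarrow>
     pair (pfst e) (pair (pfst (psnd e)) (pair (psnd (psnd e)) (pair b z))) \<in> D"

text \<open>By the exponential bound, a set with largest element \<open>n\<close> meets only edges
  \<open>e < n\<close>, whose endpoints lie below \<open>n\<close>. A guess therefore has to be
  right only below its largest element.\<close>

definition leaving :: "nat \<Rightarrow> nat \<Rightarrow> bool" where
  "leaving c e \<longleftrightarrow> 2 ^ Suc e \<le> c \<and> pfst e \<in> set_decode c \<and> pfst (psnd e) \<notin> set_decode c"

text \<open>All quantifiers are bounded, which makes this a decidable approximation of
  \<open>level\<close>. By \<open>leaving_less\<close>, the bound \<open>e < c\<close> loses no
  edge.\<close>

definition level_at :: "nat set \<Rightarrow> nat \<Rightarrow> nat \<Rightarrow> nat \<Rightarrow> bool" where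
  "level_at D c j s \<longleftrightarrow> j = 0 \<or>
     (\<exists>e < c. leaving c e \<and> (\<forall>b < j. \<exists>z < s. edge_refutes D e b z))"

definition level :: "nat set \<Rightarrow> nat \<Rightarrow> nat \<Rightarrow> bool" where
  "level D c j \<longleftrightarrow> j = 0 \<or> (\<exists>e. leaving c e \<and> (\<forall>b < j. \<exists>z. edge_refutes D e b z))"

lemma leaving_less: "leaving c e \<Longrightarrow> e < c"
  unfolding leaving_def by (meson less_exp less_le_trans Suc_lessD)

lemma level_iff: "level D c j \<longleftrightarrow> (\<exists>s. level_at D c j s)"
proof
  assume "level D c j"
  show "\<exists>s. level_at D c j s"
  proof (cases "j = 0")
    case False
    then obtain e where e: "leaving c e" "\<forall>b < j. \<exists>z. edge_refutes D e b z"
      using \<open>level D c j\<close> unfolding level_def by blast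
    then obtain z where z: "\<forall>b < j. edge_refutes D e b (z b)" by metis
    \<comment> \<open>The sum of the finitely many witnesses serves as a common bound.\<close>
    have "z b < Suc (\<Sum>b<j. z b)" if "b < j" for b
      using member_le_sum[of b "{..<j}" z] that by (simp add: less_Suc_eq_le)
    then show ?thesis using e z leaving_less unfolding level_at_def by blast
  qed (simp add: level_at_def)
next
  assume "\<exists>s. level_at D c j s"
  then show "level D c j" unfolding level_def level_at_def by blast
qed

lemma level_mono: "level D c j \<Longrightarrow> i \<le> j \<Longrightarrow> level D c i"
  unfolding level_def by (meson le_zero_eq less_le_trans)

definition column :: "nat set \<Rightarrow> nat \<Rightarrow> (nat \<times> nat) set" where
  "column D u = {(c, k). level D c k \<or> u \<in> set_decode c \<and> level D c (k - 1)}"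

lemma set_decode_pred:
  assumes "computable f" "computable g"
  shows "computable_pred (\<lambda>x. f x \<in> set_decode (g x))"
  unfolding set_decode_def mem_Collect_eq by (intro computable_intros assms) simp

text \<open>Through \<open>level_at\<close> the columns are enumerable uniformly in
  \<open>u\<close>. They are already closed downward, so passing from \<open>re_set\<close> to
  \<open>W\<close> adds nothing.\<close>

lemma W_column:
  assumes "decidable D"
  shows "\<exists>f. computable f \<and> (\<forall>u. W (f u) = column D u)"
proof -
  have "computable_pred (\<lambda>x. x \<in> D)"
    using assms by (simp add: computable_pred_decidable)
  note D = computable_pred_compose[OF this]
  let ?R = "\<lambda>u c k s. level_at D c k s \<or> u \<in> set_decode c \<and> level_at D c (k - 1) s"
  have "computable_pred (\<lambda>n. ?R (pfst (pfst n)) (pfst (psnd (pfst n))) (psnd (psnd (pfst n))) (psnd n))"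
    unfolding level_at_def leaving_def edge_refutes_def
    by (intro computable_intros D set_decode_pred)
  from re_set_param[OF this] obtain f where f: "computable f"
    and re: "\<And>u. re_set (f u) = {v. \<exists>s. ?R u (pfst v) (psnd v) s}" by auto
  have "W (f u) = column D u" for u
  proof -
    have "pair c k \<in> re_set (f u) \<longleftrightarrow> (c, k) \<in> column D u" for c k
      unfolding re column_def by (auto simp: level_iff)
    moreover have "(c, l) \<in> column D u" if "(c, k) \<in> column D u" "l \<le> k" for c k l
      using that level_mono[of D c k l] level_mono[of D c "k - 1" "l - 1"]
      by (auto simp: column_def)
    ultimately show ?thesis by (auto simp: W_def)
  qed
  with f show ?thesis by blast
qed

text \<open>The marker \<open>n\<close> is the top bit of the code. It makes the code large even for
  small \<open>V\<close> and limits the edges that can leave the set.\<close>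

lemma set_encode_insert_bounds:
  assumes "V \<subseteq> {..<n}"
  shows "2 ^ n \<le> set_encode (insert n V)" "set_encode (insert n V) < 2 ^ Suc n"
    "set_decode (set_encode (insert n V)) = insert n V"
proof -
  have fin: "finite V" using assms finite_subset by blast
  have "n \<notin> V" using assms by auto
  then have enc: "set_encode (insert n V) = 2 ^ n + set_encode V"
    using fin by (simp add: set_encode_insert)
  have "set_encode V \<le> (\<Sum>k<n. 2 ^ k)"
    unfolding set_encode_def by (rule sum_mono2) (use assms in auto)
  also have "\<dots> < 2 ^ n" by (induction n) auto
  finally show "set_encode (insert n V) < 2 ^ Suc n" using enc by simp
  show "2 ^ n \<le> set_encode (insert n V)" using enc by simp
  show "set_decode (set_encode (insert n V)) = insert n V" using fin by simp
qed

section \<open>Correctness of the reduction\<close>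

context
  fixes D :: "nat set" and P :: "(nat \<times> nat) set"
  assumes preorder: "preorder_on UNIV P"
    and P_iff: "\<And>x y. (x, y) \<in> P \<longleftrightarrow> (\<exists>a. \<forall>b. \<exists>z. pair x (pair y (pair a (pair b z))) \<in> D)"
begin

lemma P_refl: "(x, x) \<in> P" and P_trans: "(x, y) \<in> P \<Longrightarrow> (y, z) \<in> P \<Longrightarrow> (x, z) \<in> P"
  using preorder unfolding preorder_on_def by (auto dest: refl_onD transD)

lemma embeddable_if_preorder:
  assumes "W i = column D x" "W j = column D y" "(x, y) \<in> P"
  shows "computably_embeddable (G i) (G j)"
proof -
  obtain a where a: "\<forall>b. \<exists>z. pair x (pair y (pair a (pair b z))) \<in> D"
    using assms(3) unfolding P_iff by blast
  define e where "e = pair x (pair y a)"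
  have e: "\<forall>b. \<exists>z. edge_refutes D e b z" using a by (simp add: edge_refutes_def e_def)
  show ?thesis
  proof (rule embeddableI[of "{..<2 ^ Suc e}"])
    fix c k assume ck: "(c, k) \<in> W i"
    show "(c, k) \<in> W j \<or> c \<in> {..<2 ^ Suc e} \<and> (c, k - 1) \<in> W j"
    proof (cases "c < 2 ^ Suc e")
      case True
      \<comment> \<open>The heights of one column for different numbers differ by at most
        one.\<close>
      have "level D c (k - 1)"
        using ck level_mono[of D c k "k - 1"] by (auto simp: assms column_def)
      then show ?thesis using True by (simp add: assms column_def)
    next
      case False
      \<comment> \<open>Here the edge \<open>e\<close> leaves the guessed set and passes every test,
        so the column is infinitely high in both groups. In the other cases membership of
        \<open>x\<close> implies that of \<open>y\<close>.\<close>
      have "level D c k" if "x \<in> set_decode c" "y \<notin> set_decode c"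
        unfolding level_def leaving_def using e that False by (intro disjI2 exI[of _ e]) (auto simp: e_def)
      then show ?thesis using ck by (auto simp: assms column_def)
    qed
  qed simp
qed

text \<open>Every leaving edge is a false witness and fails at some \<open>b e\<close>. Only
  finitely many edges leave the set, so the sum of these values bounds all levels.\<close>

lemma level_bounded:
  assumes "\<And>e. leaving c e \<Longrightarrow> (pfst e, pfst (psnd e)) \<notin> P"
  shows "\<exists>k. level D c k \<and> \<not> level D c (Suc k)"
proof -
  have "\<forall>e. \<exists>b. leaving c e \<longrightarrow> (\<forall>z. \<not> edge_refutes D e b z)"
    using assms unfolding P_iff edge_refutes_def by blast
  then obtain b where b: "\<And>e z. leaving c e \<Longrightarrow> \<not> edge_refutes D e (b e) z" by metis
  have "\<not> level D c (Suc (\<Sum>e<c. b e))"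
  proof
    assume "level D c (Suc (\<Sum>e<c. b e))"
    then obtain e where e: "leaving c e" "\<forall>i < Suc (\<Sum>e<c. b e). \<exists>z. edge_refutes D e i z"
      unfolding level_def by auto
    have "b e \<le> (\<Sum>e<c. b e)" using leaving_less[OF e(1)] by (intro member_le_sum) auto
    then show False using e b[OF e(1)] by (meson le_imp_less_Suc)
  qed
  moreover have "level D c 0" by (simp add: level_def)
  ultimately show ?thesis using nat_induct[of "level D c"] by blast
qed

lemma preorder_if_embeddable:
  assumes "W i = column D x" "W j = column D y" "computably_embeddable (G i) (G j)"
  shows "(x, y) \<in> P"
proof (rule ccontr)
  assume not: "(x, y) \<notin> P"
  have "\<exists>c \<ge> m. \<exists>k. (c, Suc k) \<in> W i \<and> (c, Suc k) \<notin> W j" for m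
  proof -
    \<comment> \<open>Being above \<open>m\<close> makes the column large; being above
      \<open>x\<close> and \<open>y\<close> puts \<open>x\<close> into the guess and keeps the
      marker distinct from \<open>y\<close>.\<close>
    define n where "n = Suc (m + x + y)"
    define V where "V = {u. u < n \<and> (x, u) \<in> P}"
    define c where "c = set_encode (insert n V)"
    have "V \<subseteq> {..<n}" by (auto simp: V_def)
    note c = set_encode_insert_bounds[OF this, folded c_def]
    have "(pfst e, pfst (psnd e)) \<notin> P" if "leaving c e" for e
    proof
      assume edge: "(pfst e, pfst (psnd e)) \<in> P"
      have "(2 :: nat) ^ Suc e < 2 ^ Suc n" using that c(2) unfolding leaving_def by linarith
      then have "Suc e < Suc n" by (rule power_less_imp_less_exp[rotated]) simp
      then have "e < n" by simp
      then have "pfst e < n" "pfst (psnd e) < n"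
        using pfst_le[of e] psnd_le[of e] pfst_le[of "psnd e"] by linarith+
      \<comment> \<open>Both endpoints lie below \<open>n\<close>, where the guess is the true
        upward closure of \<open>x\<close>, so a correct edge cannot leave it.\<close>
      then show False using that edge P_trans by (auto simp: leaving_def c(3) V_def)
    qed
    then obtain k where "level D c k" "\<not> level D c (Suc k)" using level_bounded by blast
    moreover have "x \<in> set_decode c" "y \<notin> set_decode c"
      using not P_refl by (auto simp: c(3) V_def n_def)
    \<comment> \<open>With last level \<open>k\<close>, the column has height \<open>Suc k\<close>
      for \<open>x\<close>, a member of the guess, and only \<open>k\<close> for
      \<open>y\<close>.\<close>
    ultimately have "(c, Suc k) \<in> W i" "(c, Suc k) \<notin> W j"
      by (auto simp: assms column_def)
    moreover have "m \<le> c"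
      using c(1) less_exp[of n] by (simp add: n_def)
    ultimately show ?thesis by blast
  qed
  then have "infinite {c. \<exists>k. (c, Suc k) \<in> W i \<and> (c, Suc k) \<notin> W j}"
    unfolding infinite_nat_iff_unbounded_le by blast
  with finite_if_embeddable[OF assms(3)] show False by contradiction
qed

end

theorem theorem4p13:
  shows "Sigma03_preorder {(i, j). computably_embeddable (G i) (G j)} \<and>
    (\<forall>P :: (nat \<times> nat) set. Sigma03_preorder P \<longrightarrow>
      (\<exists>f :: nat \<Rightarrow> nat. computable f \<and>
        (\<forall>x y. (x, y) \<in> P \<longleftrightarrow> computably_embeddable (G (f x)) (G (f y)))))"
proof (intro conjI allI impI)
  fix P :: "(nat \<times> nat) set" assume "Sigma03_preorder P"
  then obtain D where P: "preorder_on UNIV P" and D: "decidable D"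
    and P_iff: "\<And>x y. (x, y) \<in> P \<longleftrightarrow> (\<exists>a. \<forall>b. \<exists>z. pair x (pair y (pair a (pair b z))) \<in> D)"
    unfolding Sigma03_preorder_def Sigma03_def by blast
  obtain f where f: "computable f" "\<And>u. W (f u) = column D u" using W_column[OF D] by blast
  have "(x, y) \<in> P \<longleftrightarrow> computably_embeddable (G (f x)) (G (f y))" for x y
    using embeddable_if_preorder[OF P P_iff f(2) f(2)] preorder_if_embeddable[OF P P_iff f(2) f(2)] by blast
  with f(1) show "\<exists>f. computable f \<and> (\<forall>x y. (x, y) \<in> P \<longleftrightarrow> computably_embeddable (G (f x)) (G (f y)))"
    by blast
qed (rule Sigma03_preorder_embeddable)

end
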